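(* Let $Y\subset\mathbb C$ be relatively separated, let $X=X^{(1)}\sqcup\cdots\sqcup X^{(J)}$ be a finite labeled union of relatively separated subsets of $\mathbb C$, and let $T=(T_{x,y})_{x\in X,y\in Y}$ be a rapidly localized matrix. Fix $0<p,q\le\infty$ and $\nu\in\mathbb R$. Suppose that there exists $C_0>0$ such that $$\|c\|_{\ell_{w_\nu}^{p,q}(Y)}\le C_0\|Tc\|_{\ell_{w_\nu}^{p,q}(X)},\qquad c\in c_{00}(Y).$$ Then there is a constant $C>0$, depending only on $p,q,\nu,C_0$ and on $X,Y,T$, such that $$\|c\|_{\ell^2(Y)}\le C\|Tc\|_{\ell^2(X)},\qquad c\in\ell^2(Y).$$
   Context: A set $Y\subset\mathbb C$ is relatively separated if $\sup_{z\in\mathbb C}\#(Y\cap B(z,1))<\infty$, with $B(z,1)$ the open unit disk centered at $z$. A finite labeled union $X=X^{(1)}\sqcup\cdots\sqcup X^{(J)}$ is the disjoint union of the sets $X^{(j)}\subset\mathbb C$: its elements are points carrying their label $j$ (the same point of $\mathbb C$ may occur with several labels), and moduli and distances $|x|$, $|x-y|$ of labeled points refer to their planar coordinates. A matrix $T=(T_{x,y})_{x\in X,y\in Y}$ is rapidly localized if for every $N>0$ there is $C_N>0$ with $|T_{x,y}|\le C_N(1+|x-y|)^{-N}$ for all $x\in X$, $y\in Y$; it acts by $(Tc)_x=\sum_{y\in Y}T_{x,y}c_y$. With $Z=X$ or $Y$, $A_k:=\{z\in\mathbb C:k\le|z|<k+1\}$ and $Z_k$ the set of (labeled) points of $Z$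 with planar coordinate in $A_k$, $k=0,1,2,\dots$, the space $\ell_{w_\nu}^{p,q}(Z)$ consists of complex sequences $a=(a_z)_{z\in Z}$ with $\|a\|_{\ell_{w_\nu}^{p,q}(Z)}:=\left\|\left((1+k)^\nu\|a|_{Z_k}\|_{\ell^p(Z_k)}\right)_{k\ge0}\right\|_{\ell^q}<\infty$. $c_{00}(Y)$ is the space of finitely supported complex sequences on $Y$. *)

theory Defs
  imports "HOL-Analysis.Analysis"
begin

definition relatively_separated :: "complex set \<Rightarrow> bool" where
  "relatively_separated Y \<longleftrightarrow>
     (\<exists>n::nat. \<forall>z. finite (Y \<inter> ball z 1) \<and> card (Y \<inter> ball z 1) \<le> n)"

text \<open>A labeled point is a pair \<open>(j, z)\<close> of a label \<open>j\<close> and its planar coordinate \<open>z\<close>.\<close>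

definition labeled_union :: "nat \<Rightarrow> (nat \<Rightarrow> complex set) \<Rightarrow> (nat \<times> complex) set" where
  "labeled_union J Xs = (SIGMA j:{1..J}. Xs j)"

text \<open>
  Labeled and unlabeled index sets are treated uniformly: below, the argument \<open>pos\<close> gives the
  planar coordinate of an index, so it is \<^const>\<open>snd\<close> for a labeled union and
  \<^term>\<open>\<lambda>z. z\<close> for a subset of the plane.

  Matrices and sequences are total functions, but only their values on the given index sets
  are ever used.
\<close>

definition rapidly_localized ::
    "(nat \<times> complex) set \<Rightarrow> complex set \<Rightarrow> (nat \<times> complex \<Rightarrow> complex \<Rightarrow> complex) \<Rightarrow> bool" where
  "rapidly_localized X Y T \<longleftrightarrow>
     (\<forall>N::real. N > 0 \<longrightarrow> (\<exists>C>0. \<forall>x\<in>X. \<forall>y\<in>Y. cmod (T x y) \<le> C * (1 + cmod (snd x - y)) powr (- N)))"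

definition mat_apply :: "complex set \<Rightarrow> ('x \<Rightarrow> complex \<Rightarrow> complex) \<Rightarrow> (complex \<Rightarrow> complex) \<Rightarrow> 'x \<Rightarrow> complex" where
  "mat_apply Y T c x = (\<Sum>\<^sub>\<infinity>y\<in>Y. T x y * c y)"

text \<open>Only used for exponents \<open>r > 0\<close>.\<close>

definition ennreal_powr :: "ennreal \<Rightarrow> real \<Rightarrow> ennreal" where
  "ennreal_powr t r = (if t = \<infinity> then \<infinity> else ennreal (enn2real t powr r))"

text \<open>
  The \<open>\<ell>\<^sup>p\<close> (quasi-)norm, for \<open>0 < p \<le> \<infinity>\<close>, of a family with values in \<open>[0, \<infinity>]\<close>. It is
  \<open>\<infinity>\<close> exactly when the family is not in \<open>\<ell>\<^sup>p\<close>. Infinite values are allowed because the inner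
  norms of a mixed norm may be infinite.
\<close>

definition lp_norm :: "ennreal \<Rightarrow> 'i set \<Rightarrow> ('i \<Rightarrow> ennreal) \<Rightarrow> ennreal" where
  "lp_norm p S f =
     (if p = \<infinity> then (SUP i\<in>S. f i)
      else ennreal_powr (\<Sum>\<^sub>\<infinity>i\<in>S. ennreal_powr (f i) (enn2real p)) (1 / enn2real p))"

definition seq_norm :: "ennreal \<Rightarrow> 'i set \<Rightarrow> ('i \<Rightarrow> complex) \<Rightarrow> ennreal" where
  "seq_norm p S a = lp_norm p S (\<lambda>i. ennreal (cmod (a i)))"

definition annulus_part :: "('i \<Rightarrow> complex) \<Rightarrow> 'i set \<Rightarrow> nat \<Rightarrow> 'i set" where
  "annulus_part pos Z k = {z \<in> Z. real k \<le> cmod (pos z) \<and> cmod (pos z) < real k + 1}"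

definition mixed_norm ::
    "('i \<Rightarrow> complex) \<Rightarrow> ennreal \<Rightarrow> ennreal \<Rightarrow> real \<Rightarrow> 'i set \<Rightarrow> ('i \<Rightarrow> complex) \<Rightarrow> ennreal" where
  "mixed_norm pos p q \<nu> Z a =
     lp_norm q (UNIV :: nat set)
       (\<lambda>k. ennreal ((1 + real k) powr \<nu>) * seq_norm p (annulus_part pos Z k) a)"

definition l2_space :: "'i set \<Rightarrow> ('i \<Rightarrow> complex) set" where
  "l2_space S = {a. seq_norm 2 S a < \<infinity>}"

definition finitely_supported :: "'i set \<Rightarrow> ('i \<Rightarrow> complex) set" where
  "finitely_supported S = {a. finite {i \<in> S. a i \<noteq> 0}}"

end

theory Submission
  imports Defs
begin

text \<open>
  Stability of a rapidly localized matrix \<open>T\<close> in one mixed norm forces a pointwise bound which no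
  longer refers to that norm:
  \<open>\<bar>c z\<bar> \<le> C * (SUP x\<in>X. (1 + \<bar>x - z\<bar>) ^ (-2) * \<bar>T c x\<bar>)\<close> for all \<open>z \<in> Y\<close> and all bounded \<open>c\<close>. The
  \<open>\<ell>\<^sup>2\<close> estimate follows because a kernel with this decay acts boundedly on \<open>\<ell>\<^sup>2\<close>.

  To obtain the pointwise bound at \<open>z\<close>, test the assumed inequality with \<open>w * c\<close>, where
  \<open>w y = (1 + \<epsilon> * \<bar>y - z\<bar>) ^ (-k)\<close>. With a cutoff of compact support in place of \<open>w\<close>, the commutator
  would involve values of \<open>c\<close> at points where the cutoff vanishes, which \<open>w * c\<close> does not control. For
  the polynomial weight, the relative difference of \<open>w\<close> at two points is at most \<open>\<epsilon>\<close> times a power of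
  their distance, so the commutator of \<open>T\<close> with \<open>w\<close> is \<open>\<epsilon>\<close> times a localized matrix applied to
  \<open>w * c\<close>, with constants independent of \<open>\<epsilon>\<close> and \<open>z\<close> (\<open>commutator_bound\<close>). As localized matrices are
  bounded in the mixed norm, the commutator term can be absorbed for one fixed small \<open>\<epsilon>\<close>, which
  leaves \<open>\<parallel>w * c\<parallel> \<le> C * \<parallel>w * T c\<parallel>\<close>. Now \<open>w * c\<close> is at least \<open>\<bar>c z\<bar>\<close> times the unit vector at \<open>z\<close>, and
  \<open>w * T c\<close> is dominated by a localized kernel applied to a multiple of the same unit vector, so the
  norm of that vector cancels (\<open>pointwise_bound_finite_support\<close>). A truncation argument removes the
  finite support (\<open>pointwise_bound_bounded\<close>).

  Boundedness of localized kernels for all \<open>0 < p, q \<le> \<infinity>\<close>, without a case distinction at \<open>1\<close>, rests on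
  replacing sums \<open>(\<Sum>y. \<kappa> x y * g y)\<close> by suprema \<open>(SUP y. \<kappa> x y * g y)\<close> at the cost of a few orders of decay
  (\<open>lp_norm_decay_bound\<close>). For the mixed norm this test is used on the points and again on the numbers
  of the annuli (\<open>mixed_lp_decay_bound\<close>). The geometric input is that a uniformly locally finite
  family has bounded sums of \<open>(1 + \<bar>x - z\<bar>) ^ (-4)\<close> (\<open>ulf_imp_decay_sum_bounded\<close>).
\<close>

section \<open>Polynomial decay\<close>

definition decay :: "nat \<Rightarrow> complex \<Rightarrow> complex \<Rightarrow> real" where
  "decay n u v = 1 / (1 + dist u v) ^ n"

lemma one_plus_dist_pos [simp]: "0 < 1 + dist u v"
  by (simp add: add_pos_nonneg)

lemma one_plus_dist_nonzero [simp]: "1 + dist u v \<noteq> 0"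
  using one_plus_dist_pos[of u v] by linarith

lemma decay_pos: "0 < decay n u v"
  by (simp add: decay_def)

lemma decay_nonneg [simp]: "0 \<le> decay n u v"
  by (simp add: decay_def)

lemma decay_self [simp]: "decay n u u = 1"
  by (simp add: decay_def)

lemma decay_commute: "decay n u v = decay n v u"
  by (simp add: decay_def dist_commute)

lemma decay_add: "decay (m + n) u v = decay m u v * decay n u v"
  by (simp add: decay_def power_add)

lemma decay_antimono: "m \<le> n \<Longrightarrow> decay n u v \<le> decay m u v"
  unfolding decay_def by (intro frac_le power_increasing zero_less_power) auto

lemma decay_le_1: "decay n u v \<le> 1"
  using decay_antimono[of 0 n u v] by (simp add: decay_def)

lemma one_plus_dist_triangle:
  fixes u v w :: complex
  shows "1 + dist u w \<le> (1 + dist u v) * (1 + dist v w)"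
proof -
  have "1 + dist u w \<le> 1 + (dist u v + dist v w)"
    by (simp add: dist_triangle)
  also have "\<dots> \<le> (1 + dist u v) * (1 + dist v w)"
    by (simp add: algebra_simps)
  finally show ?thesis .
qed

text \<open>
  Peetre's inequality: decay measured from \<open>u\<close> can be traded for decay measured from \<open>v\<close> at the
  price of decay in \<open>dist u v\<close>.
\<close>
lemma decay_triangle: "decay n u v * decay n v w \<le> decay n u w"
proof -
  have "(1 + dist u w) ^ n \<le> ((1 + dist u v) * (1 + dist v w)) ^ n"
    by (rule power_mono[OF one_plus_dist_triangle]) simp
  then show ?thesis
    unfolding decay_def
    by (simp add: power_mult_distrib frac_le add_pos_nonneg)
qed

lemma decay_powr_le:
  assumes "4 \<le> real n * r"
  shows "decay n u v powr r \<le> decay 4 u v"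
proof -
  have pos: "0 < 1 + dist u v" by (simp add: add_pos_nonneg)
  have "decay n u v powr r = 1 / (1 + dist u v) powr (real n * r)"
    using pos by (simp add: decay_def powr_divide powr_powr flip: powr_realpow)
  also have "\<dots> \<le> 1 / (1 + dist u v) powr 4"
    using assms by (intro frac_le powr_mono) auto
  also have "\<dots> = decay 4 u v"
    using pos powr_realpow[of "1 + dist u v" 4] by (simp add: decay_def)
  finally show ?thesis .
qed

section \<open>Uniformly locally finite families\<close>

definition uniformly_locally_finite :: "('i \<Rightarrow> complex) \<Rightarrow> 'i set \<Rightarrow> bool" where
  "uniformly_locally_finite pos S \<longleftrightarrow>
     (\<exists>n::nat. \<forall>z. finite {i\<in>S. pos i \<in> ball z 1} \<and> card {i\<in>S. pos i \<in> ball z 1} \<le> n)"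

text \<open>
  The exponent \<open>4\<close> is one for which \<open>(1 + \<bar>z\<bar>) ^ (-4)\<close> is summable over a lattice in the plane.
  The bound is on finite partial sums, so it serves sums of reals and of extended reals alike.
\<close>
definition decay_sum_bounded :: "('i \<Rightarrow> complex) \<Rightarrow> 'i set \<Rightarrow> real \<Rightarrow> bool" where
  "decay_sum_bounded pos S D \<longleftrightarrow>
     0 < D \<and> (\<forall>z F. finite F \<and> F \<subseteq> S \<longrightarrow> (\<Sum>i\<in>F. decay 4 (pos i) z) \<le> D)"

lemma decay_sum_boundedD:
  assumes "decay_sum_bounded pos S D"
  shows "0 < D" "finite F \<Longrightarrow> F \<subseteq> S \<Longrightarrow> (\<Sum>i\<in>F. decay 4 (pos i) z) \<le> D"
  using assms by (auto simp: decay_sum_bounded_def)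

lemma decay_sum_bounded_subset:
  "decay_sum_bounded pos S D \<Longrightarrow> S' \<subseteq> S \<Longrightarrow> decay_sum_bounded pos S' D"
  by (auto simp: decay_sum_bounded_def)

lemma relatively_separated_imp_ulf:
  "relatively_separated Y \<Longrightarrow> uniformly_locally_finite (\<lambda>z. z) Y"
  by (simp add: relatively_separated_def uniformly_locally_finite_def Int_def)

lemma labeled_union_ulf:
  assumes "\<And>j. j \<in> {1..J} \<Longrightarrow> relatively_separated (Xs j)"
  shows "uniformly_locally_finite snd (labeled_union J Xs)"
proof -
  have "\<forall>j\<in>{1..J}. \<exists>n::nat. \<forall>z. finite (Xs j \<inter> ball z 1) \<and> card (Xs j \<inter> ball z 1) \<le> n"
    using assms by (simp add: relatively_separated_def)
  then obtain n where n: "\<And>j z. j \<in> {1..J} \<Longrightarrow> finite (Xs j \<inter> ball z 1) \<and> card (Xs j \<inter> ball z 1) \<le> n j"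
    by metis
  have "finite {i\<in>labeled_union J Xs. snd i \<in> ball z 1} \<and>
        card {i\<in>labeled_union J Xs. snd i \<in> ball z 1} \<le> (\<Sum>j\<in>{1..J}. n j)" for z
  proof -
    have eq: "{i\<in>labeled_union J Xs. snd i \<in> ball z 1} = (SIGMA j:{1..J}. Xs j \<inter> ball z 1)"
      by (auto simp: labeled_union_def)
    show ?thesis
      unfolding eq using n by (auto simp: card_SigmaI intro!: sum_mono)
  qed
  then show ?thesis
    unfolding uniformly_locally_finite_def by blast
qed

lemma dist_of_nat: "dist (of_nat k :: complex) (of_nat l) = \<bar>real k - real l\<bar>"
proof -
  have "(of_nat k :: complex) - of_nat l = complex_of_real (real k - real l)" by simp
  then show ?thesis unfolding dist_norm by (simp only: norm_of_real)
qed

text \<open>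
  The numbers of the annuli are treated as one more family of points of the plane, so that the same
  Schur bound serves the inner and the outer norm.
\<close>
lemma of_nat_ulf: "uniformly_locally_finite (of_nat :: nat \<Rightarrow> complex) UNIV"
proof -
  have "finite {k::nat. of_nat k \<in> ball z 1} \<and> card {k::nat. of_nat k \<in> ball z 1} \<le> 3" for z :: complex
  proof (cases "{k::nat. of_nat k \<in> ball z 1} = {}")
    case True
    then show ?thesis by (simp only: finite.emptyI card.empty) simp
  next
    case False
    then obtain k0 :: nat where k0: "dist z (of_nat k0) < 1" by auto
    have sub: "{k::nat. of_nat k \<in> ball z 1} \<subseteq> {k0 - 1..k0 + 1}"
    proof
      fix k :: nat assume "k \<in> {k::nat. of_nat k \<in> ball z 1}"
      then have "dist z (of_nat k) < 1" by simp
      with k0 have "dist (of_nat k :: complex) (of_nat k0) < 2"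
        using dist_triangle3[of "of_nat k" "of_nat k0" z] by linarith
      then have "\<bar>real k - real k0\<bar> < 2" by (simp add: dist_of_nat)
      then show "k \<in> {k0 - 1..k0 + 1}" by auto
    qed
    have "card {k::nat. of_nat k \<in> ball z 1} \<le> card {k0 - 1..k0 + 1}"
      by (rule card_mono) (use sub in auto)
    also have "\<dots> \<le> 3" by simp
    finally show ?thesis using finite_subset[OF sub] by auto
  qed
  then show ?thesis
    unfolding uniformly_locally_finite_def by auto
qed

text \<open>
  Sort the points by the integer parts \<open>a\<close>, \<open>b\<close> of \<open>\<bar>Re\<bar>\<close> and \<open>\<bar>Im\<bar>\<close> of their difference to \<open>z\<close>. Each
  class lies in four unit squares, hence contains a bounded number of points, and on it
  \<open>decay 4\<close> is at most \<open>(1 + a) ^ (-2) * (1 + b) ^ (-2)\<close>, which is summable over all pairs.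
\<close>
lemma ulf_imp_decay_sum_bounded:
  assumes "uniformly_locally_finite pos S"
  shows "\<exists>D. decay_sum_bounded pos S D"
proof -
  obtain n :: nat where n: "\<And>z. finite {i\<in>S. pos i \<in> ball z 1}"
      "\<And>z. card {i\<in>S. pos i \<in> ball z 1} \<le> n"
    using assms unfolding uniformly_locally_finite_def by blast
  define g where "g k = 1 / (1 + real k) ^ 2" for k :: nat
  have g_nonneg: "0 \<le> g k" for k by (simp add: g_def)
  have "summable (\<lambda>k. inverse (real (Suc k) ^ 2))"
    using inverse_power_summable[of 2, where 'a=real] by (subst summable_Suc_iff) simp
  then have g_summable: "summable g"
    by (simp add: g_def[abs_def] inverse_eq_divide add.commute)
  define G where "G = suminf g"
  have g_sum: "sum g A \<le> G" if "finite A" for A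
    unfolding G_def using g_summable that g_nonneg by (intro sum_le_suminf) auto
  have G_nonneg: "0 \<le> G" using g_sum[of "{}"] by simp
  have main: "(\<Sum>i\<in>F. decay 4 (pos i) z) \<le> real (4 * n) * (G * G)" if F: "finite F" "F \<subseteq> S" for z F
  proof -
    define cell where "cell i = (nat \<lfloor>\<bar>Re (pos i - z)\<bar>\<rfloor>, nat \<lfloor>\<bar>Im (pos i - z)\<bar>\<rfloor>)" for i
    define h where "h = (\<lambda>(a, b). g a * g b)"
    have h_nonneg: "0 \<le> h u" for u by (simp add: h_def g_nonneg split_beta)
    have le_h: "decay 4 (pos i) z \<le> h (cell i)" for i
    proof -
      define d where "d = dist (pos i) z"
      have re: "real (nat \<lfloor>\<bar>Re (pos i - z)\<bar>\<rfloor>) \<le> d"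
        using abs_Re_le_cmod[of "pos i - z"] unfolding d_def dist_norm by linarith
      have im: "real (nat \<lfloor>\<bar>Im (pos i - z)\<bar>\<rfloor>) \<le> d"
        using abs_Im_le_cmod[of "pos i - z"] unfolding d_def dist_norm by linarith
      have "decay 4 (pos i) z = 1 / ((1 + d) ^ 2) * (1 / (1 + d) ^ 2)"
        by (simp add: decay_def d_def flip: power_add)
      also have "\<dots> \<le> h (cell i)"
        unfolding h_def cell_def prod.case g_def
        using re im by (intro mult_mono frac_le power_mono zero_less_power add_pos_nonneg) simp_all
      finally show ?thesis .
    qed
    have fibre: "card {i\<in>F. cell i = u} \<le> 4 * n" for u
    proof -
      obtain a b where u: "u = (a, b)" by (cases u)
      \<comment> \<open>the centres of the four unit squares that make up the class\<close>
      define c where "c s t = z + Complex (s * (real a + 1/2)) (t * (real b + 1/2))" for s t :: real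
      define Q where "Q s t = {i\<in>S. pos i \<in> ball (c s t) 1}" for s t
      have sub: "{i\<in>F. cell i = u} \<subseteq> (\<Union>(s,t)\<in>{1,-1::real}\<times>{1,-1::real}. Q s t)"
      proof
        fix i assume "i \<in> {i\<in>F. cell i = u}"
        then have i: "i \<in> S" "nat \<lfloor>\<bar>Re (pos i - z)\<bar>\<rfloor> = a" "nat \<lfloor>\<bar>Im (pos i - z)\<bar>\<rfloor> = b"
          using F by (auto simp: cell_def u)
        define x where "x = Re (pos i - z)"
        define y where "y = Im (pos i - z)"
        have sign: "\<exists>s::real. (s = 1 \<or> s = -1) \<and> \<bar>r - s * (real m + 1/2)\<bar> \<le> 1/2"
          if "nat \<lfloor>\<bar>r\<bar>\<rfloor> = m" for r :: real and m
        proof -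
          have "real m \<le> \<bar>r\<bar>" "\<bar>r\<bar> < real m + 1"
            unfolding that[symmetric] by linarith+
          then show ?thesis
            by (intro exI[of _ "if 0 \<le> r then 1 else -1"]) (auto simp: abs_if)
        qed
        obtain s :: real where s: "s = 1 \<or> s = -1" "\<bar>x - s * (real a + 1/2)\<bar> \<le> 1/2"
          using sign[OF i(2)] x_def by auto
        obtain t :: real where t: "t = 1 \<or> t = -1" "\<bar>y - t * (real b + 1/2)\<bar> \<le> 1/2"
          using sign[OF i(3)] y_def by auto
        have "dist (c s t) (pos i) = norm (pos i - c s t)"
          by (simp add: dist_norm norm_minus_commute)
        also have "\<dots> = sqrt ((x - s * (real a + 1/2))\<^sup>2 + (y - t * (real b + 1/2))\<^sup>2)"
          by (simp add: cmod_def c_def x_def y_def algebra_simps)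
        also have "\<dots> \<le> sqrt ((1/2)\<^sup>2 + (1/2)\<^sup>2)"
          using s(2) t(2) by (intro real_sqrt_le_mono add_mono abs_le_square_iff[THEN iffD1]) auto
        also have "\<dots> < 1" by (simp add: power2_eq_square)
        finally have "i \<in> Q s t" using i(1) by (simp add: Q_def)
        then show "i \<in> (\<Union>(s,t)\<in>{1,-1::real}\<times>{1,-1::real}. Q s t)" using s(1) t(1) by blast
      qed
      have finQ: "finite (Q s t)" and cardQ: "card (Q s t) \<le> n" for s t
        using n by (auto simp: Q_def)
      have "card {i\<in>F. cell i = u} \<le> card (\<Union>(s,t)\<in>{1,-1::real}\<times>{1,-1::real}. Q s t)"
        by (rule card_mono[OF _ sub]) (auto intro: finQ)
      also have "\<dots> \<le> (\<Sum>(s,t)\<in>{1,-1::real}\<times>{1,-1::real}. card (Q s t))"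
        by (rule order_trans[OF card_UN_le]) (auto intro!: sum_mono)
      also have "\<dots> \<le> (\<Sum>v\<in>{1,-1::real}\<times>{1,-1::real}. n)"
        by (rule sum_mono) (auto intro: cardQ)
      also have "\<dots> = 4 * n" by simp
      finally show ?thesis .
    qed
    have "(\<Sum>i\<in>F. decay 4 (pos i) z) \<le> (\<Sum>i\<in>F. h (cell i))"
      by (rule sum_mono) (rule le_h)
    also have "\<dots> = (\<Sum>u\<in>cell ` F. \<Sum>i | i \<in> F \<and> cell i = u. h (cell i))"
      by (rule sum.image_gen[OF F(1)])
    also have "\<dots> = (\<Sum>u\<in>cell ` F. real (card {i\<in>F. cell i = u}) * h u)"
      by (rule sum.cong) auto
    also have "\<dots> \<le> (\<Sum>u\<in>cell ` F. real (4 * n) * h u)"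
      using fibre h_nonneg by (intro sum_mono mult_right_mono) (auto simp del: of_nat_mult)
    also have "\<dots> = real (4 * n) * (\<Sum>u\<in>cell ` F. h u)"
      by (simp add: sum_distrib_left)
    also have "\<dots> \<le> real (4 * n) * (\<Sum>u\<in>fst ` cell ` F \<times> snd ` cell ` F. h u)"
      using F h_nonneg by (intro mult_left_mono sum_mono2 finite_cartesian_product finite_imageI subset_fst_snd) simp_all
    also have "\<dots> = real (4 * n) * (sum g (fst ` cell ` F) * sum g (snd ` cell ` F))"
      by (simp add: h_def sum_product sum.cartesian_product)
    also have "\<dots> \<le> real (4 * n) * (G * G)"
      using F g_sum G_nonneg by (intro mult_left_mono mult_mono sum_nonneg g_nonneg) auto
    finally show ?thesis .
  qed
  have "decay_sum_bounded pos S (real (4 * n) * (G * G) + 1)"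
    unfolding decay_sum_bounded_def using main G_nonneg
    by (intro conjI allI impI add_nonneg_pos mult_nonneg_nonneg order_trans[OF main]) auto
  then show ?thesis by blast
qed

section \<open>Sums with values in the extended half line\<close>

lemma infsum_ennreal_SUP:
  fixes f :: "'a \<Rightarrow> ennreal"
  shows "infsum f S = (SUP F\<in>{F. finite F \<and> F \<subseteq> S}. sum f F)"
  by (rule nonneg_infsum_complete) simp

lemma infsum_ennreal_leI:
  fixes f :: "'a \<Rightarrow> ennreal"
  assumes "\<And>F. finite F \<Longrightarrow> F \<subseteq> S \<Longrightarrow> sum f F \<le> B"
  shows "infsum f S \<le> B"
  unfolding infsum_ennreal_SUP using assms by (auto intro: SUP_least)

lemma sum_le_infsum_ennreal:
  fixes f :: "'a \<Rightarrow> ennreal"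
  shows "finite F \<Longrightarrow> F \<subseteq> S \<Longrightarrow> sum f F \<le> infsum f S"
  unfolding infsum_ennreal_SUP by (auto intro: SUP_upper)

lemma le_infsum_ennreal:
  fixes f :: "'a \<Rightarrow> ennreal"
  shows "i \<in> S \<Longrightarrow> f i \<le> infsum f S"
  using sum_le_infsum_ennreal[of "{i}" S f] by simp

lemma infsum_ennreal_mono:
  fixes f g :: "'a \<Rightarrow> ennreal"
  shows "(\<And>i. i \<in> S \<Longrightarrow> f i \<le> g i) \<Longrightarrow> infsum f S \<le> infsum g S"
  by (rule infsum_mono) (auto intro: nonneg_summable_on_complete)

lemma infsum_ennreal_cmult:
  fixes f :: "'a \<Rightarrow> ennreal"
  shows "infsum (\<lambda>i. c * f i) S = c * infsum f S"
  unfolding infsum_ennreal_SUP by (simp add: SUP_mult_left_ennreal sum_distrib_left)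

lemma infsum_ennreal_add:
  fixes f g :: "'a \<Rightarrow> ennreal"
  shows "infsum (\<lambda>i. f i + g i) S = infsum f S + infsum g S"
  by (rule infsum_add) (auto intro: nonneg_summable_on_complete)

lemma sum_infsum_ennreal:
  fixes f :: "'a \<Rightarrow> 'b \<Rightarrow> ennreal"
  shows "(\<Sum>x\<in>F. \<Sum>\<^sub>\<infinity>y\<in>S. f x y) = (\<Sum>\<^sub>\<infinity>y\<in>S. \<Sum>x\<in>F. f x y)"
proof (cases "finite F")
  case True
  then show ?thesis by induction (simp_all add: infsum_ennreal_add)
qed simp

section \<open>Powers of extended nonnegative reals\<close>

lemma ennreal_powr_ennreal [simp]: "0 \<le> t \<Longrightarrow> ennreal_powr (ennreal t) r = ennreal (t powr r)"
  by (simp add: ennreal_powr_def)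

lemma ennreal_powr_top [simp]: "ennreal_powr top r = top"
  by (simp add: ennreal_powr_def)

lemma ennreal_powr_0 [simp]: "ennreal_powr 0 r = 0"
  by (simp add: ennreal_powr_def)

lemma ennreal_powr_mono:
  assumes "0 < r" "s \<le> t"
  shows "ennreal_powr s r \<le> ennreal_powr t r"
proof (cases t)
  case (real b)
  with assms obtain a where "s = ennreal a" "0 \<le> a" by (cases s) (auto simp: top_unique)
  with real assms show ?thesis by (auto simp: ennreal_le_iff intro!: powr_mono2)
qed simp

lemma ennreal_powr_powr:
  assumes "0 < r" "r * s = 1"
  shows "ennreal_powr (ennreal_powr t r) s = t"
  using assms by (cases t) (auto simp: powr_powr)

lemma ennreal_powr_mult:
  assumes "0 < r"
  shows "ennreal_powr (s * t) r = ennreal_powr s r * ennreal_powr t r"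
proof (cases s; cases t)
  fix a b :: real assume "0 \<le> a" "s = ennreal a" "0 \<le> b" "t = ennreal b"
  then show ?thesis by (simp add: powr_mult flip: ennreal_mult)
qed (use assms in \<open>auto simp: ennreal_mult_top ennreal_top_mult ennreal_eq_0_iff\<close>)

lemma ennreal_powr_SUP_le:
  assumes "0 < r"
  shows "ennreal_powr (SUP i\<in>S. f i) r \<le> (\<Sum>\<^sub>\<infinity>i\<in>S. ennreal_powr (f i) r)"
proof -
  have "f i \<le> ennreal_powr (\<Sum>\<^sub>\<infinity>i\<in>S. ennreal_powr (f i) r) (1 / r)" if "i \<in> S" for i
  proof -
    have "f i = ennreal_powr (ennreal_powr (f i) r) (1 / r)"
      using assms by (simp add: ennreal_powr_powr)
    also have "\<dots> \<le> ennreal_powr (\<Sum>\<^sub>\<infinity>i\<in>S. ennreal_powr (f i) r) (1 / r)"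
      using assms that by (intro ennreal_powr_mono le_infsum_ennreal) auto
    finally show ?thesis .
  qed
  then have "(SUP i\<in>S. f i) \<le> ennreal_powr (\<Sum>\<^sub>\<infinity>i\<in>S. ennreal_powr (f i) r) (1 / r)"
    by (rule SUP_least)
  then have "ennreal_powr (SUP i\<in>S. f i) r \<le> ennreal_powr (ennreal_powr (\<Sum>\<^sub>\<infinity>i\<in>S. ennreal_powr (f i) r) (1 / r)) r"
    by (rule ennreal_powr_mono[OF assms])
  then show ?thesis using assms by (simp add: ennreal_powr_powr)
qed

text \<open>
  For \<open>r \<ge> 1\<close> convexity would give a smaller constant; bounding the sum by twice the maximum covers
  all exponents at once, and constants are immaterial here.
\<close>
lemma ennreal_powr_add_le:
  assumes "0 < r"
  shows "ennreal_powr (s + t) r \<le> ennreal (2 powr r) * (ennreal_powr s r + ennreal_powr t r)"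
proof -
  have "s + t \<le> 2 * max s t"
    by (simp add: mult_2 add_mono)
  then have "ennreal_powr (s + t) r \<le> ennreal_powr (2 * max s t) r"
    by (rule ennreal_powr_mono[OF assms])
  also have "\<dots> = ennreal (2 powr r) * ennreal_powr (max s t) r"
    using ennreal_powr_ennreal[of 2 r] by (simp add: ennreal_powr_mult[OF assms])
  also have "\<dots> \<le> ennreal (2 powr r) * (ennreal_powr s r + ennreal_powr t r)"
    by (intro mult_left_mono) (auto simp: max_def add_increasing add_increasing2)
  finally show ?thesis .
qed

section \<open>Quasi-norms and Schur bounds in \<open>\<ell>\<^sup>p\<close>\<close>

lemma lp_norm_ennreal:
  "0 < r \<Longrightarrow> lp_norm (ennreal r) S f = ennreal_powr (\<Sum>\<^sub>\<infinity>i\<in>S. ennreal_powr (f i) r) (1 / r)"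
  by (simp add: lp_norm_def)

lemma exponent_cases:
  assumes "0 < (p :: ennreal)"
  obtains "p = top" | r where "0 < r" "p = ennreal r"
  using assms by (cases p) auto

lemma lp_norm_top: "lp_norm top S f = (SUP i\<in>S. f i)"
  by (simp add: lp_norm_def)

lemma lp_norm_mono:
  assumes "0 < p" "\<And>i. i \<in> S \<Longrightarrow> f i \<le> g i"
  shows "lp_norm p S f \<le> lp_norm p S g"
  using assms(1)
proof (cases p rule: exponent_cases)
  case 1
  then show ?thesis using assms by (auto simp: lp_norm_top intro!: SUP_mono)
next
  case (2 r)
  note r = this
  then show ?thesis
    using assms by (auto simp: lp_norm_ennreal intro!: ennreal_powr_mono infsum_ennreal_mono)
qed

lemma lp_norm_cong:
  assumes "\<And>i. i \<in> S \<Longrightarrow> f i = g i"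
  shows "lp_norm p S f = lp_norm p S g"
  unfolding lp_norm_def using assms by (auto intro!: SUP_cong arg_cong2[where f=ennreal_powr] infsum_cong)

lemma lp_norm_cmult:
  assumes "0 < p"
  shows "lp_norm p S (\<lambda>i. a * f i) = a * lp_norm p S f"
  using assms(1)
proof (cases p rule: exponent_cases)
  case 1
  then show ?thesis by (simp add: lp_norm_top SUP_mult_left_ennreal)
next
  case (2 r)
  note r = this
  then show ?thesis
    by (simp add: lp_norm_ennreal ennreal_powr_mult infsum_ennreal_cmult ennreal_powr_powr)
qed

lemma lp_norm_single:
  assumes "0 < p" "i \<in> S" "\<And>j. j \<in> S \<Longrightarrow> j \<noteq> i \<Longrightarrow> f j = 0"
  shows "lp_norm p S f = f i"
  using assms(1)
proof (cases p rule: exponent_cases)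
  case 1
  have "(SUP i\<in>S. f i) = f i"
  proof (rule antisym)
    show "(SUP i\<in>S. f i) \<le> f i" using assms by (intro SUP_least) (metis order_refl zero_le)
  qed (use assms in \<open>auto intro: SUP_upper\<close>)
  then show ?thesis using 1 by (simp add: lp_norm_top)
next
  case (2 r)
  note r = this
  have "(\<Sum>\<^sub>\<infinity>i\<in>S. ennreal_powr (f i) r) = (\<Sum>\<^sub>\<infinity>i\<in>{i}. ennreal_powr (f i) r)"
    using assms by (intro infsum_cong_neutral) auto
  then show ?thesis using r by (simp add: lp_norm_ennreal ennreal_powr_powr)
qed

lemma lp_norm_zero:
  assumes "0 < p" "\<And>j. j \<in> S \<Longrightarrow> f j = 0"
  shows "lp_norm p S f = 0"
proof -
  have "lp_norm p S f = lp_norm p S (\<lambda>j. 0 * f j)"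
    using assms by (intro lp_norm_cong) auto
  also have "\<dots> = 0 * lp_norm p S f"
    by (rule lp_norm_cmult[OF assms(1)])
  finally show ?thesis by simp
qed

lemma lp_norm_add_le:
  assumes "0 < p"
  shows "\<exists>K>0. \<forall>S f g. lp_norm p (S :: 'i set) (\<lambda>i. f i + g i) \<le> ennreal K * (lp_norm p S f + lp_norm p S g)"
  using assms(1)
proof (cases p rule: exponent_cases)
  case 1
  have "lp_norm p S (\<lambda>i. f i + g i) \<le> lp_norm p S f + lp_norm p S g" for S :: "'i set" and f g
    unfolding 1 lp_norm_top by (intro SUP_least add_mono SUP_upper)
  then show ?thesis by (intro exI[of _ 1]) auto
next
  case (2 r)
  note r = this
  have "lp_norm p S (\<lambda>i. f i + g i) \<le> ennreal (2 * 2 powr (1 / r)) * (lp_norm p S f + lp_norm p S g)"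
    for S :: "'i set" and f g
  proof -
    have "(\<Sum>\<^sub>\<infinity>i\<in>S. ennreal_powr (f i + g i) r)
        \<le> (\<Sum>\<^sub>\<infinity>i\<in>S. ennreal (2 powr r) * (ennreal_powr (f i) r + ennreal_powr (g i) r))"
      by (intro infsum_ennreal_mono ennreal_powr_add_le r)
    then have "lp_norm p S (\<lambda>i. f i + g i)
        \<le> ennreal_powr (\<Sum>\<^sub>\<infinity>i\<in>S. ennreal (2 powr r) * (ennreal_powr (f i) r + ennreal_powr (g i) r)) (1 / r)"
      unfolding r(2) lp_norm_ennreal[OF r(1)] using r(1) by (intro ennreal_powr_mono) auto
    also have "\<dots> = 2 * ennreal_powr ((\<Sum>\<^sub>\<infinity>i\<in>S. ennreal_powr (f i) r) + (\<Sum>\<^sub>\<infinity>i\<in>S. ennreal_powr (g i) r)) (1 / r)"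
      using r(1) by (simp add: infsum_ennreal_cmult infsum_ennreal_add ennreal_powr_mult powr_powr)
    also have "\<dots> \<le> 2 * (ennreal (2 powr (1 / r)) * (lp_norm p S f + lp_norm p S g))"
      unfolding r(2) lp_norm_ennreal[OF r(1)] using r(1) by (intro mult_left_mono ennreal_powr_add_le) auto
    also have "\<dots> = ennreal (2 * 2 powr (1 / r)) * (lp_norm p S f + lp_norm p S g)"
      by (simp add: ennreal_mult mult.assoc)
    finally show ?thesis .
  qed
  then show ?thesis by (intro exI[of _ "2 * 2 powr (1 / r)"]) auto
qed

text \<open>
  Taking the \<open>\<ell>\<^sup>p\<close> norm blockwise, with the same exponent inside and outside, loses nothing.
\<close>
lemma lp_norm_partition_le:
  assumes "0 < p"
  shows "lp_norm p S f \<le> lp_norm p UNIV (\<lambda>l. lp_norm p {i\<in>S. lev i = l} f)"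
  using assms(1)
proof (cases p rule: exponent_cases)
  case 1
  show ?thesis
    unfolding 1 lp_norm_top by (rule SUP_least) (auto intro: SUP_upper2)
next
  case (2 r)
  note r = this
  let ?h = "\<lambda>i. ennreal_powr (f i) r"
  have "infsum ?h S \<le> (\<Sum>\<^sub>\<infinity>l. infsum ?h {i\<in>S. lev i = l})"
  proof (rule infsum_ennreal_leI)
    fix F assume F: "finite F" "F \<subseteq> S"
    have "sum ?h F = (\<Sum>l\<in>lev ` F. sum ?h {i\<in>F. lev i = l})"
      by (rule sum.image_gen[OF F(1)])
    also have "\<dots> \<le> (\<Sum>l\<in>lev ` F. infsum ?h {i\<in>S. lev i = l})"
      using F by (intro sum_mono sum_le_infsum_ennreal) auto
    also have "\<dots> \<le> (\<Sum>\<^sub>\<infinity>l. infsum ?h {i\<in>S. lev i = l})"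
      using F by (intro sum_le_infsum_ennreal) auto
    finally show "sum ?h F \<le> (\<Sum>\<^sub>\<infinity>l. infsum ?h {i\<in>S. lev i = l})" .
  qed
  then show ?thesis
    unfolding r(2) lp_norm_ennreal[OF r(1)]
    using r(1) by (auto simp: ennreal_powr_powr intro: ennreal_powr_mono)
qed

text \<open>
  A bound on \<open>\<ell>\<^sup>p\<close> for the maximal operator of a kernel whose column sums of \<open>p\<close>-th powers are at
  most \<open>D\<close>; for \<open>p = \<infinity>\<close>, of a kernel bounded by \<open>1\<close>.
\<close>
definition schur_bound :: "ennreal \<Rightarrow> real \<Rightarrow> real" where
  "schur_bound p D = (if p = \<infinity> then 1 else D powr (1 / enn2real p))"

lemma schur_bound_pos: "decay_sum_bounded pos S D \<Longrightarrow> 0 < schur_bound p D"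
  using decay_sum_boundedD(1) by (force simp: schur_bound_def)

text \<open>
  A Schur test for the maximal operator \<open>g \<mapsto> (SUP y. \<kappa> x y * g y)\<close> with a polynomially decaying
  kernel. Working with a supremum instead of a sum makes the argument uniform in \<open>0 < p < \<infinity>\<close>: the
  \<open>p\<close>-th power of a supremum is at most the sum of the \<open>p\<close>-th powers, and the column sums of
  \<open>\<kappa> ^ p\<close> are bounded once the decay order \<open>N\<close> satisfies \<open>N * p \<ge> 4\<close>. A sum against a rapidly decaying
  kernel is dominated by such a supremum, by giving up four orders of decay.
\<close>
lemma lp_norm_decay_bound:
  assumes D: "decay_sum_bounded pos S D" and p: "0 < p" "4 \<le> of_nat N * p"
    and le: "\<And>x. x \<in> S \<Longrightarrow> f x \<le> (SUP y\<in>S'. ennreal (decay N (pos x) (pos' y)) * g y)"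
  shows "lp_norm p S f \<le> ennreal (schur_bound p D) * lp_norm p S' g"
  using p(1)
proof (cases p rule: exponent_cases)
  case 1
  have "f x \<le> (SUP y\<in>S'. g y)" if "x \<in> S" for x
  proof (rule order_trans[OF le[OF that]], rule SUP_mono)
    fix y assume "y \<in> S'"
    have "ennreal (decay N (pos x) (pos' y)) * g y \<le> 1 * g y"
      by (intro mult_right_mono) (auto simp: decay_le_1)
    with \<open>y \<in> S'\<close> show "\<exists>m\<in>S'. ennreal (decay N (pos x) (pos' y)) * g y \<le> g m" by auto
  qed
  then show ?thesis
    unfolding 1 lp_norm_top by (auto simp: schur_bound_def intro: SUP_least)
next
  case (2 r)
  have "4 \<le> real N * r"
  proof -
    have "ennreal 4 \<le> ennreal (real N * r)"
      using p(2) 2 by (simp add: ennreal_mult ennreal_of_nat_eq_real_of_nat)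
    then show ?thesis using 2(1) by (simp add: ennreal_le_iff del: ennreal_numeral)
  qed
  then have kernel: "ennreal_powr (ennreal (decay N u v)) r \<le> ennreal (decay 4 u v)" for u v
    using decay_powr_le[of N r u v] by (simp add: ennreal_leI)
  have D_nonneg: "0 \<le> D" using decay_sum_boundedD(1)[OF D] by simp
  have "(\<Sum>\<^sub>\<infinity>x\<in>S. ennreal_powr (f x) r) \<le> ennreal D * (\<Sum>\<^sub>\<infinity>y\<in>S'. ennreal_powr (g y) r)"
  proof (rule infsum_ennreal_leI)
    fix F assume F: "finite F" "F \<subseteq> S"
    have "(\<Sum>x\<in>F. ennreal_powr (f x) r)
        \<le> (\<Sum>x\<in>F. \<Sum>\<^sub>\<infinity>y\<in>S'. ennreal (decay 4 (pos x) (pos' y)) * ennreal_powr (g y) r)"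
    proof (rule sum_mono)
      fix x assume "x \<in> F"
      then have "ennreal_powr (f x) r \<le> ennreal_powr (SUP y\<in>S'. ennreal (decay N (pos x) (pos' y)) * g y) r"
        using F 2(1) le by (intro ennreal_powr_mono) auto
      also have "\<dots> \<le> (\<Sum>\<^sub>\<infinity>y\<in>S'. ennreal_powr (ennreal (decay N (pos x) (pos' y)) * g y) r)"
        by (rule ennreal_powr_SUP_le[OF 2(1)])
      also have "\<dots> \<le> (\<Sum>\<^sub>\<infinity>y\<in>S'. ennreal (decay 4 (pos x) (pos' y)) * ennreal_powr (g y) r)"
        unfolding ennreal_powr_mult[OF 2(1)] by (intro infsum_ennreal_mono mult_right_mono kernel) auto
      finally show "ennreal_powr (f x) r \<le> \<dots>" .
    qed
    also have "\<dots> = (\<Sum>\<^sub>\<infinity>y\<in>S'. ennreal (\<Sum>x\<in>F. decay 4 (pos x) (pos' y)) * ennreal_powr (g y) r)"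
      by (simp add: sum_infsum_ennreal flip: sum_ennreal sum_distrib_right)
    also have "\<dots> \<le> (\<Sum>\<^sub>\<infinity>y\<in>S'. ennreal D * ennreal_powr (g y) r)"
      using F decay_sum_boundedD(2)[OF D] by (intro infsum_ennreal_mono mult_right_mono ennreal_leI) auto
    also have "\<dots> = ennreal D * (\<Sum>\<^sub>\<infinity>y\<in>S'. ennreal_powr (g y) r)"
      by (rule infsum_ennreal_cmult)
    finally show "(\<Sum>x\<in>F. ennreal_powr (f x) r) \<le> \<dots>" .
  qed
  then have "lp_norm p S f \<le> ennreal_powr (ennreal D * (\<Sum>\<^sub>\<infinity>y\<in>S'. ennreal_powr (g y) r)) (1 / r)"
    unfolding 2(2) lp_norm_ennreal[OF 2(1)] using 2(1) by (intro ennreal_powr_mono) auto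
  also have "\<dots> = ennreal (schur_bound p D) * lp_norm p S' g"
    using 2 D_nonneg by (simp add: schur_bound_def lp_norm_ennreal ennreal_powr_mult)
  finally show ?thesis .
qed

section \<open>Schur bounds in the mixed norms\<close>

text \<open>
  The mixed norm for families with values in \<open>[0, \<infinity>]\<close>, which is closed under the suprema and
  majorants that occur below.
\<close>
definition mixed_lp ::
    "('i \<Rightarrow> complex) \<Rightarrow> ennreal \<Rightarrow> ennreal \<Rightarrow> real \<Rightarrow> 'i set \<Rightarrow> ('i \<Rightarrow> ennreal) \<Rightarrow> ennreal" where
  "mixed_lp pos p q \<nu> Z f =
     lp_norm q (UNIV :: nat set)
       (\<lambda>k. ennreal ((1 + real k) powr \<nu>) * lp_norm p (annulus_part pos Z k) f)"

lemma mixed_norm_eq: "mixed_norm pos p q \<nu> Z a = mixed_lp pos p q \<nu> Z (\<lambda>i. ennreal (cmod (a i)))"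
  by (simp add: mixed_norm_def mixed_lp_def seq_norm_def)

lemma mixed_lp_mono:
  assumes "0 < p" "0 < q" "\<And>i. i \<in> Z \<Longrightarrow> f i \<le> g i"
  shows "mixed_lp pos p q \<nu> Z f \<le> mixed_lp pos p q \<nu> Z g"
  unfolding mixed_lp_def using assms
  by (intro lp_norm_mono mult_left_mono) (auto simp: annulus_part_def)

lemma mixed_lp_cmult:
  assumes "0 < p" "0 < q"
  shows "mixed_lp pos p q \<nu> Z (\<lambda>i. a * f i) = a * mixed_lp pos p q \<nu> Z f"
  unfolding mixed_lp_def using assms
  by (simp add: lp_norm_cmult mult.left_commute[of _ a])

lemma mixed_lp_add_le:
  assumes "0 < p" "0 < q"
  shows "\<exists>K>0. \<forall>f g. mixed_lp pos p q \<nu> Z (\<lambda>i. f i + g i)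
                 \<le> ennreal K * (mixed_lp pos p q \<nu> Z f + mixed_lp pos p q \<nu> Z g)"
proof -
  obtain K where K: "0 < K" "\<And>S f g. lp_norm p (S :: 'a set) (\<lambda>i. f i + g i) \<le> ennreal K * (lp_norm p S f + lp_norm p S g)"
    using lp_norm_add_le[OF assms(1)] by metis
  obtain L where L: "0 < L" "\<And>S f g. lp_norm q (S :: nat set) (\<lambda>i. f i + g i) \<le> ennreal L * (lp_norm q S f + lp_norm q S g)"
    using lp_norm_add_le[OF assms(2)] by metis
  have "mixed_lp pos p q \<nu> Z (\<lambda>i. f i + g i) \<le> ennreal (K * L) * (mixed_lp pos p q \<nu> Z f + mixed_lp pos p q \<nu> Z g)" for f g
  proof -
    let ?w = "\<lambda>k. ennreal ((1 + real k) powr \<nu>)"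
    let ?n = "\<lambda>h k. lp_norm p (annulus_part pos Z k) h"
    have "mixed_lp pos p q \<nu> Z (\<lambda>i. f i + g i)
        \<le> lp_norm q UNIV (\<lambda>k. ?w k * (ennreal K * (?n f k + ?n g k)))"
      unfolding mixed_lp_def by (intro lp_norm_mono assms mult_left_mono K) auto
    also have "\<dots> = ennreal K * lp_norm q UNIV (\<lambda>k. ?w k * ?n f k + ?w k * ?n g k)"
      unfolding lp_norm_cmult[OF assms(2), symmetric] by (simp add: distrib_left mult.left_commute)
    also have "\<dots> \<le> ennreal K * (ennreal L * (mixed_lp pos p q \<nu> Z f + mixed_lp pos p q \<nu> Z g))"
      unfolding mixed_lp_def by (intro mult_left_mono L) auto
    also have "\<dots> = ennreal (K * L) * (mixed_lp pos p q \<nu> Z f + mixed_lp pos p q \<nu> Z g)"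
      using K(1) L(1) by (simp add: ennreal_mult mult.assoc)
    finally show ?thesis .
  qed
  then show ?thesis using K(1) L(1) by (intro exI[of _ "K * L"]) auto
qed

lemma mem_annulus_part_iff: "i \<in> annulus_part pos Z k \<longleftrightarrow> i \<in> Z \<and> nat \<lfloor>cmod (pos i)\<rfloor> = k"
proof -
  have "nat \<lfloor>r\<rfloor> = k \<longleftrightarrow> real k \<le> r \<and> r < real k + 1" if "0 \<le> r" for r
    using that by (auto simp: nat_eq_iff floor_eq_iff)
  then show ?thesis by (simp add: annulus_part_def)
qed

text \<open>
  Norm inequalities between multiples of one unit vector can be turned into inequalities between the
  coefficients, because its norm can be cancelled.
\<close>
lemma mixed_lp_single:
  assumes "0 < p" "0 < q" "i \<in> Z"
  shows "0 < mixed_lp pos p q \<nu> Z (\<lambda>j. if j = i then 1 else 0)"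
    and "mixed_lp pos p q \<nu> Z (\<lambda>j. if j = i then 1 else 0) < \<infinity>"
proof -
  let ?f = "\<lambda>j. if j = i then 1 else 0 :: ennreal"
  define k where "k = nat \<lfloor>cmod (pos i)\<rfloor>"
  have "lp_norm p (annulus_part pos Z k) ?f = 1"
    using assms lp_norm_single[of p i "annulus_part pos Z k" ?f] by (simp add: mem_annulus_part_iff k_def)
  moreover have "lp_norm p (annulus_part pos Z l) ?f = 0" if "l \<noteq> k" for l
    using assms that by (intro lp_norm_zero) (auto simp: mem_annulus_part_iff k_def)
  ultimately have "mixed_lp pos p q \<nu> Z ?f = ennreal ((1 + real k) powr \<nu>)"
    unfolding mixed_lp_def using assms(2) by (subst lp_norm_single[of q k]) auto
  then show "0 < mixed_lp pos p q \<nu> Z ?f" "mixed_lp pos p q \<nu> Z ?f < \<infinity>"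
    by simp_all
qed

text \<open>
  Points in the \<open>k\<close>-th and \<open>l\<close>-th annulus are at distance at least \<open>\<bar>k - l\<bar> - 1\<close>.
\<close>
lemma decay_le_level_decay:
  fixes u v :: complex
  assumes "real k \<le> cmod u" "cmod u < real k + 1" "real l \<le> cmod v" "cmod v < real l + 1"
  shows "decay n u v \<le> 2 ^ n * decay n (of_nat k) (of_nat l)"
proof -
  have "\<bar>cmod u - cmod v\<bar> \<le> dist u v"
    unfolding dist_norm by (rule norm_triangle_ineq3)
  then have "\<bar>real k - real l\<bar> \<le> 1 + dist u v"
    using assms by (intro abs_leI) auto
  also have "\<dots> \<le> 1 + 2 * dist u v" by simp
  finally have "1 + \<bar>real k - real l\<bar> \<le> 2 * (1 + dist u v)" by (simp add: algebra_simps)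
  then have "(1 + \<bar>real k - real l\<bar>) ^ n \<le> 2 ^ n * (1 + dist u v) ^ n"
    unfolding power_mult_distrib[symmetric] by (rule power_mono) simp
  then have "1 / (2 ^ n * (1 + dist u v) ^ n) \<le> 1 / (1 + \<bar>real k - real l\<bar>) ^ n"
    by (rule frac_le[rotated 3]) (simp_all add: add_pos_nonneg)
  then have "2 ^ n * (1 / (2 ^ n * (1 + dist u v) ^ n)) \<le> 2 ^ n * (1 / (1 + \<bar>real k - real l\<bar>) ^ n)"
    by (rule mult_left_mono) simp
  then show ?thesis by (simp add: decay_def dist_of_nat)
qed

text \<open>
  The weight \<open>(1 + k) powr \<nu>\<close> is moderate: passing from \<open>k\<close> to \<open>l\<close> costs at most \<open>\<bar>\<nu>\<bar>\<close> powers of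
  \<open>1 + \<bar>k - l\<bar>\<close>.
\<close>
lemma weight_decay_le:
  assumes "\<bar>\<nu>\<bar> \<le> real m"
  shows "(1 + real k) powr \<nu> * decay m (of_nat k) (of_nat l) \<le> (1 + real l) powr \<nu>"
proof -
  define d where "d = 1 + \<bar>real k - real l\<bar>"
  have d: "1 \<le> d" by (simp add: d_def)
  have k: "1 + real k \<le> (1 + real l) * d" and l: "1 + real l \<le> (1 + real k) * d"
    using one_plus_dist_triangle[of 0 "of_nat k" "of_nat l"] one_plus_dist_triangle[of 0 "of_nat l" "of_nat k"]
    by (simp_all add: d_def dist_of_nat abs_minus_commute)
  have dm: "d powr \<bar>\<nu>\<bar> \<le> d ^ m"
    using assms d by (simp add: powr_mono flip: powr_realpow)
  have "(1 + real k) powr \<nu> \<le> (1 + real l) powr \<nu> * d powr \<bar>\<nu>\<bar>"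
  proof (cases "0 \<le> \<nu>")
    case True
    have "(1 + real k) powr \<nu> \<le> ((1 + real l) * d) powr \<nu>"
      using k True by (intro powr_mono2) auto
    then show ?thesis using True d by (simp add: powr_mult)
  next
    case False
    have "((1 + real k) * d) powr \<nu> \<le> (1 + real l) powr \<nu>"
      using l False by (intro powr_mono2') auto
    then have "(1 + real k) powr \<nu> * d powr \<nu> * d powr (- \<nu>) \<le> (1 + real l) powr \<nu> * d powr (- \<nu>)"
      using d by (intro mult_right_mono) (auto simp: powr_mult)
    then show ?thesis using False d by (simp add: mult.assoc flip: powr_add)
  qed
  also have "\<dots> \<le> (1 + real l) powr \<nu> * d ^ m"
    by (intro mult_left_mono dm) auto
  finally show ?thesis
    using d by (simp add: decay_def dist_of_nat d_def[symmetric] divide_le_eq)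
qed

text \<open>
  The Schur test for mixed norms. The decay order is spent in four portions: \<open>M\<close> for the Schur test
  in \<open>\<ell>\<^sup>p\<close> from the points to the points of one annulus, \<open>M\<close> for replacing the \<open>\<ell>\<^sup>p\<close> norm over the
  annuli by a supremum over them, \<open>m\<close> for moving the weight, and \<open>N\<close> for the Schur test in \<open>\<ell>\<^sup>q\<close> over
  the annuli. The last three are available because distances of points control distances of annuli.
\<close>
lemma mixed_lp_decay_bound:
  assumes X: "decay_sum_bounded posX X D"
    and p: "0 < p" "4 \<le> of_nat M * p" and q: "0 < q" "4 \<le> of_nat N * q"
    and m: "\<bar>\<nu>\<bar> \<le> real m"
  shows "\<exists>B>0. \<forall>f g. (\<forall>x\<in>X. f x \<le> (SUP y\<in>Y. ennreal (decay (M + (M + (m + N))) (posX x) (posY y)) * g y))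
      \<longrightarrow> mixed_lp posX p q \<nu> X f \<le> ennreal B * mixed_lp posY p q \<nu> Y g"
proof -
  obtain E where E: "decay_sum_bounded (of_nat :: nat \<Rightarrow> complex) UNIV E"
    using ulf_imp_decay_sum_bounded[OF of_nat_ulf] by blast
  define n where "n = M + (m + N)"
  define c where "c = schur_bound p D * (schur_bound p E * 2 ^ n)"
  define B where "B = schur_bound q E * c"
  have c_pos: "0 < c" and B_pos: "0 < B"
    using schur_bound_pos[OF X] schur_bound_pos[OF E] by (simp_all add: c_def B_def)
  have "mixed_lp posX p q \<nu> X f \<le> ennreal B * mixed_lp posY p q \<nu> Y g"
    if le: "\<And>x. x \<in> X \<Longrightarrow> f x \<le> (SUP y\<in>Y. ennreal (decay (M + n) (posX x) (posY y)) * g y)" for f g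
  proof -
    define \<alpha> where "\<alpha> l = lp_norm p (annulus_part posY Y l) g" for l
    define w where "w k = (1 + real k) powr \<nu>" for k :: nat
    let ?d = "\<lambda>j k l. decay j (of_nat k) (of_nat l)"
    have annulus: "lp_norm p (annulus_part posX X k) f
        \<le> ennreal c * (SUP l. ennreal (?d (m + N) k l) * \<alpha> l)" for k
    proof -
      let ?H = "SUP l. ennreal (?d (m + N) k l) * \<alpha> l"
      define lev where "lev y = nat \<lfloor>cmod (posY y)\<rfloor>" for y
      define h where "h y = ennreal (2 ^ n * ?d n k (lev y)) * g y" for y
      have parts: "{y\<in>Y. lev y = l} = annulus_part posY Y l" for l
        by (auto simp: mem_annulus_part_iff lev_def)
      have "lp_norm p (annulus_part posX X k) f \<le> ennreal (schur_bound p D) * lp_norm p Y h"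
      proof (rule lp_norm_decay_bound[OF decay_sum_bounded_subset[OF X] p])
        show "annulus_part posX X k \<subseteq> X" by (auto simp: annulus_part_def)
        fix x assume x: "x \<in> annulus_part posX X k"
        have "f x \<le> (SUP y\<in>Y. ennreal (decay (M + n) (posX x) (posY y)) * g y)"
          using x by (intro le) (auto simp: annulus_part_def)
        also have "\<dots> \<le> (SUP y\<in>Y. ennreal (decay M (posX x) (posY y)) * h y)"
        proof (rule SUP_mono)
          fix y assume y: "y \<in> Y"
          then have "y \<in> annulus_part posY Y (lev y)"
            by (simp add: mem_annulus_part_iff lev_def)
          then have "decay n (posX x) (posY y) \<le> 2 ^ n * ?d n k (lev y)"
            using x by (intro decay_le_level_decay) (auto simp: annulus_part_def)
          then have "ennreal (decay (M + n) (posX x) (posY y)) * g y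
              \<le> ennreal (decay M (posX x) (posY y) * (2 ^ n * ?d n k (lev y))) * g y"
            unfolding decay_add[of M n] by (intro mult_right_mono ennreal_leI mult_left_mono) auto
          also have "\<dots> = ennreal (decay M (posX x) (posY y)) * h y"
            by (simp add: h_def ennreal_mult mult.assoc)
          finally show "\<exists>y'\<in>Y. ennreal (decay (M + n) (posX x) (posY y)) * g y
              \<le> ennreal (decay M (posX x) (posY y')) * h y'"
            using y by blast
        qed
        finally show "f x \<le> \<dots>" .
      qed
      also have "lp_norm p Y h \<le> lp_norm p UNIV (\<lambda>l. lp_norm p {y\<in>Y. lev y = l} h)"
        by (rule lp_norm_partition_le[OF p(1)])
      also have "(\<lambda>l. lp_norm p {y\<in>Y. lev y = l} h) = (\<lambda>l. ennreal (2 ^ n * ?d n k l) * \<alpha> l)"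
      proof
        fix l
        have "lp_norm p {y\<in>Y. lev y = l} h = lp_norm p {y\<in>Y. lev y = l} (\<lambda>y. ennreal (2 ^ n * ?d n k l) * g y)"
          by (rule lp_norm_cong) (auto simp: h_def)
        then show "lp_norm p {y\<in>Y. lev y = l} h = ennreal (2 ^ n * ?d n k l) * \<alpha> l"
          by (simp add: lp_norm_cmult[OF p(1)] \<alpha>_def parts)
      qed
      \<comment> \<open>With a one-point source, the Schur test bounds an \<open>\<ell>\<^sup>p\<close> norm by a supremum.\<close>
      also have "lp_norm p UNIV (\<lambda>l. ennreal (2 ^ n * ?d n k l) * \<alpha> l)
          \<le> ennreal (schur_bound p E) * lp_norm p {k} (\<lambda>_. ennreal (2 ^ n) * ?H)"
      proof (rule lp_norm_decay_bound[OF E p, where pos' = of_nat])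
        fix l :: nat
        have "ennreal (2 ^ n * ?d n k l) * \<alpha> l = ennreal (?d M l k) * (ennreal (2 ^ n) * (ennreal (?d (m + N) k l) * \<alpha> l))"
          unfolding n_def decay_add[of M "m + N"] decay_commute[of M "of_nat k"]
          by (simp add: ennreal_mult ac_simps)
        also have "\<dots> \<le> ennreal (?d M l k) * (ennreal (2 ^ n) * ?H)"
          by (intro mult_left_mono SUP_upper) auto
        finally show "ennreal (2 ^ n * ?d n k l) * \<alpha> l \<le> (SUP y\<in>{k}. ennreal (decay M (of_nat l) (of_nat y)) * (ennreal (2 ^ n) * ?H))"
          by simp
      qed
      also have "lp_norm p {k} (\<lambda>_. ennreal (2 ^ n) * ?H) = ennreal (2 ^ n) * ?H"
        using p(1) by (subst lp_norm_single[of p k]) auto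
      also have "ennreal (schur_bound p D) * (ennreal (schur_bound p E) * (ennreal (2 ^ n) * ?H)) = ennreal c * ?H"
        using schur_bound_pos[OF X, of p] schur_bound_pos[OF E, of p]
        by (simp add: c_def ennreal_mult mult.assoc)
      finally show ?thesis by (simp add: mult_left_mono)
    qed
    have "mixed_lp posX p q \<nu> X f \<le> ennreal (schur_bound q E) * lp_norm q UNIV (\<lambda>l. ennreal c * (ennreal (w l) * \<alpha> l))"
      unfolding mixed_lp_def w_def[symmetric]
    proof (rule lp_norm_decay_bound[OF E q, where pos' = of_nat])
      fix k :: nat
      have "ennreal (w k) * lp_norm p (annulus_part posX X k) f
          \<le> ennreal (w k) * (ennreal c * (SUP l. ennreal (?d (m + N) k l) * \<alpha> l))"
        by (intro mult_left_mono annulus) auto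
      also have "\<dots> = (SUP l. ennreal (w k) * (ennreal c * (ennreal (?d (m + N) k l) * \<alpha> l)))"
        by (simp add: SUP_mult_left_ennreal)
      also have "\<dots> \<le> (SUP l. ennreal (?d N k l) * (ennreal c * (ennreal (w l) * \<alpha> l)))"
      proof (rule SUP_mono)
        fix l :: nat
        have "w k * ?d m k l * ?d N k l \<le> w l * ?d N k l"
          unfolding w_def by (intro mult_right_mono weight_decay_le m) auto
        then have "ennreal (w k * ?d (m + N) k l) \<le> ennreal (w l * ?d N k l)"
          by (intro ennreal_leI) (simp add: decay_add mult.assoc)
        then have "ennreal (w k * ?d (m + N) k l) * (ennreal c * \<alpha> l) \<le> ennreal (w l * ?d N k l) * (ennreal c * \<alpha> l)"
          by (rule mult_right_mono) simp
        then show "\<exists>l'\<in>UNIV. ennreal (w k) * (ennreal c * (ennreal (?d (m + N) k l) * \<alpha> l)) \<le> ennreal (?d N k l') * (ennreal c * (ennreal (w l') * \<alpha> l'))"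
          by (intro bexI[of _ l]) (auto simp: ennreal_mult w_def ac_simps)
      qed
      finally show "ennreal (w k) * lp_norm p (annulus_part posX X k) f \<le> \<dots>" .
    qed
    also have "\<dots> = ennreal B * mixed_lp posY p q \<nu> Y g"
      using schur_bound_pos[OF E, of q] c_pos
      by (simp add: lp_norm_cmult[OF q(1)] mixed_lp_def w_def \<alpha>_def B_def ennreal_mult mult.assoc)
    finally show ?thesis .
  qed
  then show ?thesis using B_pos unfolding n_def by blast
qed

section \<open>Row sums\<close>

text \<open>
  Every row of a matrix with decay of order four is summable against bounded sequences.
\<close>
lemma decay_row_sum:
  fixes f :: "'i \<Rightarrow> complex"
  assumes D: "decay_sum_bounded pos Y D"
    and H: "0 \<le> H" "\<And>y. y \<in> Y \<Longrightarrow> cmod (f y) \<le> decay 4 (pos y) u * H"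
  shows "f summable_on Y" and "cmod (infsum f Y) \<le> D * H"
proof -
  have fin: "(\<Sum>y\<in>F. cmod (f y)) \<le> D * H" if F: "finite F" "F \<subseteq> Y" for F
  proof -
    have "(\<Sum>y\<in>F. cmod (f y)) \<le> (\<Sum>y\<in>F. decay 4 (pos y) u) * H"
      using F H(2) unfolding sum_distrib_right by (intro sum_mono) auto
    also have "\<dots> \<le> D * H"
      using F H(1) by (intro mult_right_mono decay_sum_boundedD(2)[OF D]) auto
    finally show ?thesis .
  qed
  have abs: "(\<lambda>y. cmod (f y)) summable_on Y"
    using fin by (intro nonneg_bdd_above_summable_on) (auto intro!: bdd_aboveI2)
  then show "f summable_on Y" by (rule abs_summable_summable)
  have "cmod (infsum f Y) \<le> (\<Sum>\<^sub>\<infinity>y\<in>Y. cmod (f y))"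
    by (rule norm_infsum_bound[OF abs])
  also have "\<dots> \<le> D * H"
    by (rule infsum_le_finite_sums[OF abs fin])
  finally show "cmod (infsum f Y) \<le> D * H" .
qed

section \<open>Slowly varying weights and commutators\<close>

text \<open>
  A weight centred at \<open>z\<close> with polynomial decay of order \<open>n\<close> that varies on the scale \<open>1 / \<epsilon>\<close> only.
\<close>
definition slow_weight :: "real \<Rightarrow> nat \<Rightarrow> complex \<Rightarrow> complex \<Rightarrow> real" where
  "slow_weight \<epsilon> n z u = 1 / (1 + \<epsilon> * dist u z) ^ n"

lemma slow_weight_pos: "0 < \<epsilon> \<Longrightarrow> 0 < slow_weight \<epsilon> n z u"
  by (simp add: slow_weight_def add_pos_nonneg)

lemma slow_weight_self [simp]: "slow_weight \<epsilon> n z z = 1"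
  by (simp add: slow_weight_def)

lemma slow_weight_le_1: "0 < \<epsilon> \<Longrightarrow> slow_weight \<epsilon> n z u \<le> 1"
  unfolding slow_weight_def
  using frac_le[of 1 1 1 "(1 + \<epsilon> * dist u z) ^ n"] by (simp add: one_le_power)

lemma slow_weight_le_decay:
  assumes "0 < \<epsilon>" "\<epsilon> \<le> 1"
  shows "slow_weight \<epsilon> n z u \<le> (1 / \<epsilon> ^ n) * decay n u z"
proof -
  have "\<epsilon> * (1 + dist u z) \<le> 1 + \<epsilon> * dist u z"
    using assms by (simp add: algebra_simps)
  then have "(\<epsilon> * (1 + dist u z)) ^ n \<le> (1 + \<epsilon> * dist u z) ^ n"
    using assms by (intro power_mono) auto
  then have "slow_weight \<epsilon> n z u \<le> 1 / (\<epsilon> * (1 + dist u z)) ^ n"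
    unfolding slow_weight_def using assms by (intro frac_le) auto
  then show ?thesis by (simp add: decay_def power_mult_distrib)
qed

lemma abs_power_minus_one_le:
  fixes r s \<epsilon> :: real
  assumes "0 \<le> r" "r \<le> s" "1 \<le> s" "\<bar>r - 1\<bar> \<le> \<epsilon> * s"
  shows "\<bar>r ^ n - 1\<bar> \<le> real n * \<epsilon> * s ^ n"
proof (induction n)
  case (Suc n)
  have \<epsilon>: "0 \<le> \<epsilon> * s" using assms(4) by linarith
  have "\<bar>r ^ Suc n - 1\<bar> = \<bar>r * (r ^ n - 1) + (r - 1)\<bar>"
    by (simp add: algebra_simps)
  also have "\<dots> \<le> r * \<bar>r ^ n - 1\<bar> + \<bar>r - 1\<bar>"
    using assms(1) by (intro order_trans[OF abs_triangle_ineq]) (simp add: abs_mult)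
  also have "\<dots> \<le> s * (real n * \<epsilon> * s ^ n) + \<epsilon> * s * s ^ n"
  proof (intro add_mono mult_mono)
    have "\<epsilon> * s * 1 \<le> \<epsilon> * s * s ^ n"
      using assms \<epsilon> by (intro mult_left_mono one_le_power) auto
    then show "\<bar>r - 1\<bar> \<le> \<epsilon> * s * s ^ n" using assms(4) by simp
  qed (use assms Suc in auto)
  also have "\<dots> = real (Suc n) * \<epsilon> * s ^ Suc n"
    by (simp add: algebra_simps)
  finally show ?case .
qed simp

text \<open>
  The point of this estimate is the factor \<open>\<epsilon>\<close> with all other constants independent of \<open>\<epsilon>\<close>, and that
  the difference is relative to \<open>slow_weight \<epsilon> n z v\<close> itself. The quotient \<open>r\<close> of the two weight bases
  satisfies \<open>\<bar>r - 1\<bar> \<le> \<epsilon> * dist u v\<close>, and its \<open>n\<close>-th power is compared with \<open>1\<close>.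
\<close>
lemma slow_weight_diff:
  assumes "0 < \<epsilon>" "\<epsilon> \<le> 1"
  shows "\<bar>slow_weight \<epsilon> n z v - slow_weight \<epsilon> n z u\<bar>
    \<le> \<epsilon> * real n * (1 + dist u v) ^ n * slow_weight \<epsilon> n z v"
proof -
  define a where "a = 1 + \<epsilon> * dist v z"
  define b where "b = 1 + \<epsilon> * dist u z"
  define r where "r = a / b"
  have a: "1 \<le> a" and b: "1 \<le> b" using assms by (auto simp: a_def b_def)
  have "\<bar>dist v z - dist u z\<bar> \<le> dist u v"
    using abs_dist_diff_le[of v z u] by (simp add: dist_commute)
  then have ab: "\<bar>a - b\<bar> \<le> \<epsilon> * dist u v"
    using assms(1) mult_left_mono[of "\<bar>dist v z - dist u z\<bar>" "dist u v" \<epsilon>]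
    by (simp add: a_def b_def abs_mult flip: right_diff_distrib)
  have "\<bar>r - 1\<bar> = \<bar>a - b\<bar> / b"
    using b by (simp add: r_def field_simps abs_div_pos flip: abs_divide)
  also have "\<dots> \<le> \<bar>a - b\<bar>"
    using b by (simp add: divide_le_eq mult_le_cancel_left1)
  finally have r1: "\<bar>r - 1\<bar> \<le> \<epsilon> * dist u v" using ab by simp
  then have r2: "\<bar>r - 1\<bar> \<le> \<epsilon> * (1 + dist u v)" using assms by (simp add: algebra_simps)
  have "\<epsilon> * dist u v \<le> 1 * dist u v" using assms by (intro mult_right_mono) auto
  then have r3: "r \<le> 1 + dist u v" using r1 by (simp add: abs_le_iff)
  have r0: "0 \<le> r" using a b by (simp add: r_def)
  have "slow_weight \<epsilon> n z v - slow_weight \<epsilon> n z u = - (r ^ n - 1) * slow_weight \<epsilon> n z v"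
    using a b by (simp add: slow_weight_def flip: a_def b_def) (simp add: r_def power_divide field_simps)
  then have "\<bar>slow_weight \<epsilon> n z v - slow_weight \<epsilon> n z u\<bar> = \<bar>r ^ n - 1\<bar> * slow_weight \<epsilon> n z v"
    using slow_weight_pos[OF assms(1), of n z v] by (simp add: abs_mult abs_minus_commute)
  also have "\<dots> \<le> real n * \<epsilon> * (1 + dist u v) ^ n * slow_weight \<epsilon> n z v"
    using slow_weight_pos[OF assms(1), of n z v]
    by (intro mult_right_mono abs_power_minus_one_le r0 r2 r3) auto
  finally show ?thesis by (simp add: mult.commute mult.left_commute)
qed

text \<open>
  The commutator of \<open>T\<close> with multiplication by the weight \<open>w\<close> has the entries \<open>T x y * (w y - w u)\<close>, where
  \<open>u\<close> is the position of \<open>x\<close>. Written as an operator acting on \<open>w * c\<close>, it is \<open>\<epsilon>\<close> times a matrix whose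
  decay does not depend on \<open>\<epsilon>\<close> or \<open>z\<close>: the growth \<open>(1 + dist u y) ^ n\<close> of the relative weight
  difference is absorbed by \<open>n\<close> orders of decay of \<open>T\<close>, and four more orders turn the row sum into a
  supremum.
\<close>
lemma commutator_bound:
  fixes z :: complex
  assumes D: "decay_sum_bounded (\<lambda>y. y) Y D"
    and T: "0 \<le> K" "\<And>y. y \<in> Y \<Longrightarrow> cmod (T x y) \<le> K * decay (n + (m + 4)) u y"
    and c: "\<And>y. y \<in> Y \<Longrightarrow> cmod (c y) \<le> A"
    and \<epsilon>: "0 < \<epsilon>" "\<epsilon> \<le> 1"
  defines "w \<equiv> slow_weight \<epsilon> n z"
  shows "ennreal (cmod (mat_apply Y T (\<lambda>y. of_real (w y) * c y) x - of_real (w u) * mat_apply Y T c x))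
    \<le> (SUP y\<in>Y. ennreal (decay m u y) * (ennreal (\<epsilon> * (real n * K * D)) * ennreal (cmod (of_real (w y) * c y))))"
proof (cases "Y = {}")
  case True
  then show ?thesis by (simp add: mat_apply_def)
next
  case False
  have A: "0 \<le> A" using False c norm_ge_zero order_trans by blast
  have w: "0 < w y" "w y \<le> 1" for y
    unfolding w_def using \<epsilon> by (auto intro: slow_weight_pos slow_weight_le_1)
  have D0: "0 < D" by (rule decay_sum_boundedD(1)[OF D])
  define S where "S = (SUP y\<in>Y. ennreal (decay m u y * (w y * cmod (c y))))"
  have "S \<le> ennreal A"
    unfolding S_def
  proof (rule SUP_least, rule ennreal_leI)
    fix y assume "y \<in> Y"
    have "decay m u y * (w y * cmod (c y)) \<le> 1 * (1 * A)"
      using w c[OF \<open>y \<in> Y\<close>] decay_le_1 A by (intro mult_mono mult_nonneg_nonneg) (auto intro: less_imp_le)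
    then show "decay m u y * (w y * cmod (c y)) \<le> A" by simp
  qed
  then obtain s where s: "S = ennreal s" "0 \<le> s"
    by (cases S) (auto simp: top_unique)
  have s_ge: "decay m u y * (w y * cmod (c y)) \<le> s" if "y \<in> Y" for y
  proof -
    have "ennreal (decay m u y * (w y * cmod (c y))) \<le> ennreal s"
      unfolding s(1)[symmetric] S_def using that by (rule SUP_upper)
    then show ?thesis using s(2) by (simp add: ennreal_le_iff)
  qed
  have summ: "(\<lambda>y. T x y * (of_real (v y) * c y)) summable_on Y" if v: "\<And>y. 0 \<le> v y" "\<And>y. v y \<le> 1" for v
  proof (rule decay_row_sum(1)[OF D, where u = u and H = "K * A"])
    fix y assume y: "y \<in> Y"
    have "cmod (T x y * (of_real (v y) * c y)) \<le> (K * decay (n + (m + 4)) u y) * (1 * A)"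
      unfolding norm_mult using T y c A v by (intro mult_mono) auto
    also have "\<dots> \<le> (K * decay 4 u y) * (1 * A)"
      using A T by (intro mult_left_mono mult_right_mono decay_antimono) auto
    finally show "cmod (T x y * (of_real (v y) * c y)) \<le> decay 4 y u * (K * A)"
      by (simp add: decay_commute[of 4 u] ac_simps)
  qed (use A T in simp)
  define E where "E y = T x y * (of_real (w y - w u) * c y)" for y
  have "mat_apply Y T (\<lambda>y. of_real (w y) * c y) x - of_real (w u) * mat_apply Y T c x = infsum E Y"
  proof -
    have s1: "(\<lambda>y. T x y * (of_real (w y) * c y)) summable_on Y"
      using w by (intro summ) (auto intro: less_imp_le)
    have s2: "(\<lambda>y. T x y * c y) summable_on Y"
      using summ[of "\<lambda>_. 1"] by simp
    have "infsum E Y = (\<Sum>\<^sub>\<infinity>y\<in>Y. T x y * (of_real (w y) * c y) + (- of_real (w u)) * (T x y * c y))"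
      unfolding E_def by (rule infsum_cong) (simp add: algebra_simps)
    also have "\<dots> = (\<Sum>\<^sub>\<infinity>y\<in>Y. T x y * (of_real (w y) * c y)) + (\<Sum>\<^sub>\<infinity>y\<in>Y. (- of_real (w u)) * (T x y * c y))"
      by (rule infsum_add[OF s1 summable_on_cmult_right[OF s2]])
    also have "(\<Sum>\<^sub>\<infinity>y\<in>Y. (- of_real (w u)) * (T x y * c y)) = (- of_real (w u)) * (\<Sum>\<^sub>\<infinity>y\<in>Y. T x y * c y)"
      by (rule infsum_cmult_right) (rule s2)
    finally show ?thesis by (simp add: mat_apply_def)
  qed
  moreover have "cmod (infsum E Y) \<le> D * (\<epsilon> * (real n * K) * s)"
  proof (rule decay_row_sum(2)[OF D, where u = u])
    fix y assume y: "y \<in> Y"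
    have "cmod (E y) = cmod (T x y) * (\<bar>w y - w u\<bar> * cmod (c y))"
      unfolding E_def by (simp only: norm_mult norm_of_real)
    also have "\<dots> \<le> (K * decay (n + (m + 4)) u y) * ((\<epsilon> * real n * (1 + dist u y) ^ n * w y) * cmod (c y))"
      unfolding w_def using T y slow_weight_diff[OF \<epsilon>] slow_weight_pos[OF \<epsilon>(1)] \<epsilon>(1)
      by (intro mult_mono mult_nonneg_nonneg) (auto intro: less_imp_le)
    also have "\<dots> = (\<epsilon> * (real n * K)) * decay 4 u y * (decay m u y * (w y * cmod (c y)))"
      unfolding decay_add[of n] decay_add[of m] by (simp add: decay_def[of n])
    also have "\<dots> \<le> (\<epsilon> * (real n * K)) * decay 4 u y * s"
      using s_ge[OF y] \<epsilon> T by (intro mult_left_mono) auto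
    finally show "cmod (E y) \<le> decay 4 y u * (\<epsilon> * (real n * K) * s)"
      by (simp add: decay_commute[of 4 u] ac_simps)
  qed (use s \<epsilon> T in simp)
  ultimately have "ennreal (cmod (mat_apply Y T (\<lambda>y. of_real (w y) * c y) x - of_real (w u) * mat_apply Y T c x))
      \<le> ennreal (\<epsilon> * (real n * K * D)) * S"
    using s \<epsilon> T D0 by (simp add: ennreal_leI ac_simps flip: ennreal_mult)
  also have "\<dots> = (SUP y\<in>Y. ennreal (decay m u y) * (ennreal (\<epsilon> * (real n * K * D)) * ennreal (cmod (of_real (w y) * c y))))"
    unfolding S_def SUP_mult_left_ennreal
    using w \<epsilon> T D0
    by (intro SUP_cong) (auto simp: norm_mult ennreal_mult less_imp_le mult.left_commute)
  finally show ?thesis .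
qed

section \<open>Pointwise bounds\<close>

lemma ex_nat_times_exponent_ge_4:
  assumes "0 < (p :: ennreal)"
  shows "\<exists>N. 4 \<le> of_nat N * p"
  using assms
proof (cases p rule: exponent_cases)
  case 1
  then show ?thesis by (intro exI[of _ 1]) simp
next
  case (2 r)
  obtain N :: nat where "4 / r < real N" using reals_Archimedean2 by blast
  then have "4 \<le> real N * r" using 2(1) by (simp add: field_simps)
  then have "ennreal 4 \<le> ennreal (real N * r)" by (rule ennreal_leI)
  then show ?thesis using 2 by (intro exI[of _ N]) (simp add: ennreal_mult ennreal_of_nat_eq_real_of_nat)
qed

text \<open>
  Apply the assumed stability to \<open>w * c\<close>, where \<open>w\<close> is a slow weight centred at \<open>z\<close>. By the commutator
  bound and the Schur test for mixed norms, \<open>T (w * c)\<close> differs from \<open>w * T c\<close> by at most a multiple of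
  \<open>\<epsilon>\<close> times the norm of \<open>w * c\<close>, so for a small \<open>\<epsilon>\<close>, chosen independently of \<open>z\<close> and \<open>c\<close>, the error is
  absorbed into the left-hand side. Both sides of the resulting inequality are then compared with
  multiples of the norm of the unit vector at \<open>z\<close>: on the left \<open>w * c\<close> dominates \<open>\<bar>c z\<bar>\<close> times that vector,
  on the right the decay of \<open>w\<close> makes \<open>w * T c\<close> a maximal function of the vector. The norm of the
  unit vector cancels, and with it all dependence on \<open>p\<close>, \<open>q\<close> and \<open>\<nu>\<close> except in the constant.
\<close>
lemma pointwise_bound_finite_support:
  fixes T :: "'x \<Rightarrow> complex \<Rightarrow> complex"
  assumes X: "decay_sum_bounded pos X DX" and Y: "decay_sum_bounded (\<lambda>y. y) Y DY"
    and T: "\<And>n. \<exists>K\<ge>0. \<forall>x\<in>X. \<forall>y\<in>Y. cmod (T x y) \<le> K * decay n (pos x) y"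
    and p: "0 < p" and q: "0 < q" and C0: "0 < C0"
    and stable: "\<And>c. c \<in> finitely_supported Y \<Longrightarrow>
           mixed_norm (\<lambda>z. z) p q \<nu> Y c \<le> ennreal C0 * mixed_norm pos p q \<nu> X (mat_apply Y T c)"
  shows "\<exists>C>0. \<forall>c\<in>finitely_supported Y. \<forall>z\<in>Y.
    ennreal (cmod (c z)) \<le> ennreal C * (SUP x\<in>X. ennreal (decay 2 (pos x) z) * ennreal (cmod (mat_apply Y T c x)))"
proof -
  obtain M N where M: "4 \<le> of_nat M * p" and N: "4 \<le> of_nat N * q"
    using ex_nat_times_exponent_ge_4 p q by metis
  obtain m :: nat where m: "\<bar>\<nu>\<bar> \<le> real m" using real_arch_simple by blast
  define n where "n = M + (M + (m + N))"
  let ?NX = "mixed_lp pos p q \<nu> X" and ?NY = "mixed_lp (\<lambda>z. z) p q \<nu> Y"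
  obtain B where B: "0 < B" "\<And>f g. (\<And>x. x \<in> X \<Longrightarrow> f x \<le> (SUP y\<in>Y. ennreal (decay n (pos x) y) * g y)) \<Longrightarrow> ?NX f \<le> ennreal B * ?NY g"
    using mixed_lp_decay_bound[OF X p M q N m, where Y = Y and posY = "\<lambda>y. y"] unfolding n_def by blast
  obtain B' where B': "0 < B'" "\<And>f g. (\<And>x. x \<in> Y \<Longrightarrow> f x \<le> (SUP y\<in>Y. ennreal (decay n x y) * g y)) \<Longrightarrow> ?NY f \<le> ennreal B' * ?NY g"
    using mixed_lp_decay_bound[OF Y p M q N m, where Y = Y and posY = "\<lambda>y. y"] unfolding n_def by blast
  obtain K where K: "0 < K" "\<And>f g. ?NX (\<lambda>x. f x + g x) \<le> ennreal K * (?NX f + ?NX g)"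
    using mixed_lp_add_le[OF p q] by metis
  \<comment> \<open>\<open>n\<close> orders of decay of the weight are used for the Schur test, two remain in the result.\<close>
  define k where "k = n + 2"
  obtain L where L: "0 \<le> L" "\<And>x y. x \<in> X \<Longrightarrow> y \<in> Y \<Longrightarrow> cmod (T x y) \<le> L * decay (k + (n + 4)) (pos x) y"
    using T by metis
  have DY: "0 < DY" by (rule decay_sum_boundedD(1)[OF Y])
  define \<kappa> where "\<kappa> = real k * L * DY"
  have \<kappa>: "0 \<le> \<kappa>" using L DY by (simp add: \<kappa>_def)
  define P where "P = C0 * K * B * \<kappa>"
  have P: "0 \<le> P" using C0 K B \<kappa> by (simp add: P_def)
  \<comment> \<open>makes the constant in front of the commutator term at most one half\<close>
  define \<epsilon> where "\<epsilon> = 1 / (2 * P + 1)"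
  have \<epsilon>: "0 < \<epsilon>" "\<epsilon> \<le> 1" using P by (simp_all add: \<epsilon>_def)
  have "\<epsilon> * P \<le> 1 / 2" using P by (simp add: \<epsilon>_def field_simps)
  then have small: "C0 * K * B * (\<epsilon> * \<kappa>) \<le> 1 / 2" by (simp add: P_def ac_simps)
  define C where "C = 2 * C0 * K * (B / \<epsilon> ^ k)"
  have C: "0 < C" using C0 K B \<epsilon> by (simp add: C_def)
  have "ennreal (cmod (c z)) \<le> ennreal C * (SUP x\<in>X. ennreal (decay 2 (pos x) z) * ennreal (cmod (mat_apply Y T c x)))"
    (is "_ \<le> _ * ?R")
    if c: "c \<in> finitely_supported Y" and z: "z \<in> Y" for c z
  proof -
    define w where "w = slow_weight \<epsilon> k z"
    have w_pos: "0 < w u" for u unfolding w_def by (rule slow_weight_pos[OF \<epsilon>(1)])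
    have w_le: "w u \<le> (1 / \<epsilon> ^ k) * decay k u z" for u
      unfolding w_def by (rule slow_weight_le_decay[OF \<epsilon>])
    define wc where "wc y = of_real (w y) * c y" for y
    have wc_fin: "wc \<in> finitely_supported Y"
      using c unfolding finitely_supported_def wc_def by (auto elim: finite_subset[rotated])
    let ?\<delta> = "\<lambda>y. if y = z then 1 else 0 :: ennreal"
    define \<Delta> where "\<Delta> = ?NY ?\<delta>"
    have \<Delta>: "0 < \<Delta>" "\<Delta> < top"
      using mixed_lp_single[OF p q z] by (simp_all add: \<Delta>_def)
    define W where "W = ?NY (\<lambda>y. ennreal (cmod (wc y)))"
    define V where "V = ?NX (\<lambda>x. ennreal (w (pos x) * cmod (mat_apply Y T c x)))"
    obtain A where A: "\<And>y. y \<in> Y \<Longrightarrow> cmod (c y) \<le> A"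
    proof -
      have "finite ((\<lambda>y. cmod (c y)) ` {y\<in>Y. c y \<noteq> 0} \<union> {0})"
        using c by (simp add: finitely_supported_def)
      then obtain A where "\<forall>a\<in>(\<lambda>y. cmod (c y)) ` {y\<in>Y. c y \<noteq> 0} \<union> {0}. a \<le> A"
        using bdd_above_finite unfolding bdd_above_def by blast
      then show ?thesis by (intro that[of A]) (metis (mono_tags, lifting) UnCI imageI insertI1 mem_Collect_eq norm_zero)
    qed
    \<comment> \<open>Finiteness of the norm is what allows the absorption below.\<close>
    have W_fin: "W < top"
    proof -
      have "W \<le> ennreal B' * ?NY (\<lambda>y. ennreal (A / \<epsilon> ^ k) * ?\<delta> y)"
        unfolding W_def
      proof (rule B'(2))
        fix y assume y: "y \<in> Y"
        have A0: "0 \<le> A" using A[OF y] norm_ge_zero order_trans by blast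
        have "cmod (wc y) \<le> ((1 / \<epsilon> ^ k) * decay n y z) * A"
          unfolding wc_def norm_mult
        proof (rule mult_mono)
          have "w y \<le> (1 / \<epsilon> ^ k) * decay n y z"
            using \<epsilon> by (intro order_trans[OF w_le] mult_left_mono decay_antimono) (auto simp: k_def)
          then show "cmod (of_real (w y)) \<le> (1 / \<epsilon> ^ k) * decay n y z" using w_pos[of y] by simp
        qed (use A[OF y] \<epsilon> in auto)
        also have "\<dots> = decay n y z * (A / \<epsilon> ^ k)" by simp
        finally have "ennreal (cmod (wc y)) \<le> ennreal (decay n y z) * (ennreal (A / \<epsilon> ^ k) * ?\<delta> z)"
          using A0 \<epsilon> by (simp add: ennreal_leI flip: ennreal_mult)
        then show "ennreal (cmod (wc y)) \<le> (SUP y'\<in>Y. ennreal (decay n y y') * (ennreal (A / \<epsilon> ^ k) * ?\<delta> y'))"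
          by (rule SUP_upper2[OF z])
      qed
      also have "\<dots> = ennreal B' * (ennreal (A / \<epsilon> ^ k) * \<Delta>)"
        by (simp only: mixed_lp_cmult[OF p q] \<Delta>_def)
      also have "\<dots> < top" using \<Delta> by (simp add: ennreal_mult_less_top)
      finally show ?thesis .
    qed
    have "W \<le> ennreal C0 * ?NX (\<lambda>x. ennreal (cmod (mat_apply Y T wc x)))"
      using stable[OF wc_fin] by (simp add: mixed_norm_eq W_def)
    also have "?NX (\<lambda>x. ennreal (cmod (mat_apply Y T wc x))) \<le> ennreal K * (V + ennreal (B * (\<epsilon> * \<kappa>)) * W)"
    proof -
      define E where "E x = ennreal (cmod (mat_apply Y T wc x - of_real (w (pos x)) * mat_apply Y T c x))" for x
      have "?NX (\<lambda>x. ennreal (cmod (mat_apply Y T wc x)))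
          \<le> ?NX (\<lambda>x. ennreal (w (pos x) * cmod (mat_apply Y T c x)) + E x)"
      proof (rule mixed_lp_mono[OF p q])
        fix x
        have "cmod (mat_apply Y T wc x) \<le> cmod (of_real (w (pos x)) * mat_apply Y T c x)
            + cmod (mat_apply Y T wc x - of_real (w (pos x)) * mat_apply Y T c x)"
          by (rule norm_triangle_sub)
        then show "ennreal (cmod (mat_apply Y T wc x)) \<le> ennreal (w (pos x) * cmod (mat_apply Y T c x)) + E x"
          using w_pos[of "pos x"] by (simp add: E_def norm_mult ennreal_leI flip: ennreal_plus)
      qed
      also have "\<dots> \<le> ennreal K * (V + ?NX E)"
        unfolding V_def by (rule K(2))
      also have "?NX E \<le> ennreal B * ?NY (\<lambda>y. ennreal (\<epsilon> * \<kappa>) * ennreal (cmod (wc y)))"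
      proof (rule B(2))
        fix x assume x: "x \<in> X"
        show "E x \<le> (SUP y\<in>Y. ennreal (decay n (pos x) y) * (ennreal (\<epsilon> * \<kappa>) * ennreal (cmod (wc y))))"
          unfolding E_def wc_def[abs_def] w_def \<kappa>_def
          by (rule commutator_bound[where T = T and c = c and A = A and u = "pos x", OF Y L(1) L(2)[OF x] A \<epsilon>])
      qed
      also have "\<dots> = ennreal (B * (\<epsilon> * \<kappa>)) * W"
        using B \<epsilon> \<kappa> by (simp add: mixed_lp_cmult[OF p q] W_def ennreal_mult mult.assoc)
      finally show ?thesis by (simp add: mult_left_mono add_left_mono)
    qed
    finally have "W \<le> ennreal C0 * (ennreal K * (V + ennreal (B * (\<epsilon> * \<kappa>)) * W))"
      by (simp add: mult_left_mono)
    also have "\<dots> = ennreal (C0 * K) * V + ennreal (C0 * K * B * (\<epsilon> * \<kappa>)) * W"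
      using C0 K B \<epsilon> \<kappa> by (simp add: ennreal_mult distrib_left mult.assoc)
    also have "\<dots> \<le> ennreal (C0 * K) * V + ennreal (1 / 2) * W"
      using small by (intro add_left_mono mult_right_mono ennreal_leI) auto
    finally have absorb: "W \<le> ennreal (C0 * K) * V + ennreal (1 / 2) * W" .
    have W_le: "W \<le> ennreal (2 * (C0 * K)) * V"
    proof (cases "V = top")
      case True
      then show ?thesis using C0 K by (simp add: ennreal_mult_top)
    next
      case False
      then obtain v where v: "V = ennreal v" "0 \<le> v" by (cases V) auto
      obtain r where r: "W = ennreal r" "0 \<le> r" using W_fin by (cases W) auto
      have "ennreal (C0 * K * v + 1 / 2 * r) = ennreal (C0 * K * v) + ennreal (1 / 2 * r)"
        using C0 K(1) v(2) r(2) by (intro ennreal_plus) auto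
      also have "\<dots> = ennreal (C0 * K) * ennreal v + ennreal (1 / 2) * ennreal r"
        using C0 K(1) v(2) r(2) by (intro arg_cong2[where f = plus] ennreal_mult) auto
      finally have "ennreal r \<le> ennreal (C0 * K * v + 1 / 2 * r)"
        using absorb v(1) r(1) by simp
      then have "r \<le> C0 * K * v + 1 / 2 * r"
        using C0 K v r by (subst (asm) ennreal_le_iff) auto
      then have "r \<le> 2 * (C0 * K) * v" by linarith
      then have "ennreal r \<le> ennreal (2 * (C0 * K) * v)" by (rule ennreal_leI)
      then show ?thesis using C0 K v r by (simp add: ennreal_mult)
    qed
    have V_le: "V \<le> ennreal B * ?NY (\<lambda>y. ennreal (1 / \<epsilon> ^ k) * ?R * ?\<delta> y)"
      unfolding V_def
    proof (rule B(2))
      fix x assume x: "x \<in> X"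
      let ?t = "cmod (mat_apply Y T c x)"
      have "w (pos x) * ?t \<le> (1 / \<epsilon> ^ k) * decay k (pos x) z * ?t"
        by (intro mult_right_mono w_le) auto
      then have "ennreal (w (pos x) * ?t) \<le> ennreal ((1 / \<epsilon> ^ k) * decay k (pos x) z * ?t)"
        by (rule ennreal_leI)
      also have "\<dots> = ennreal (decay n (pos x) z) * (ennreal (1 / \<epsilon> ^ k) * (ennreal (decay 2 (pos x) z) * ennreal ?t))"
        unfolding k_def decay_add[of n 2] using \<epsilon> by (simp add: ac_simps flip: ennreal_mult)
      also have "\<dots> \<le> ennreal (decay n (pos x) z) * (ennreal (1 / \<epsilon> ^ k) * ?R)"
        using x by (intro mult_left_mono SUP_upper) auto
      finally show "ennreal (w (pos x) * ?t) \<le> (SUP y\<in>Y. ennreal (decay n (pos x) y) * (ennreal (1 / \<epsilon> ^ k) * ?R * ?\<delta> y))"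
        by (intro SUP_upper2[OF z]) simp
    qed
    have "ennreal (cmod (c z)) * \<Delta> = ?NY (\<lambda>y. ennreal (cmod (c z)) * ?\<delta> y)"
      by (simp only: mixed_lp_cmult[OF p q] \<Delta>_def)
    also have "\<dots> \<le> W"
      unfolding W_def by (rule mixed_lp_mono[OF p q]) (auto simp: wc_def w_def)
    also have "\<dots> \<le> ennreal (2 * (C0 * K)) * (ennreal B * ?NY (\<lambda>y. ennreal (1 / \<epsilon> ^ k) * ?R * ?\<delta> y))"
      by (rule order_trans[OF W_le]) (intro mult_left_mono V_le, simp)
    also have "\<dots> = ennreal (2 * (C0 * K)) * (ennreal B * (ennreal (1 / \<epsilon> ^ k) * ?R * \<Delta>))"
      by (simp only: mixed_lp_cmult[OF p q] \<Delta>_def)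
    also have "\<dots> = ennreal C * ?R * \<Delta>"
    proof -
      have "C = 2 * (C0 * K) * (B * (1 / \<epsilon> ^ k))" by (simp add: C_def)
      also have "ennreal \<dots> = ennreal (2 * (C0 * K)) * (ennreal B * ennreal (1 / \<epsilon> ^ k))"
        using C0 K(1) B(1) \<epsilon>(1)
        by (intro trans[OF ennreal_mult] arg_cong2[where f = times] ennreal_mult refl) auto
      finally show ?thesis by (simp only: ac_simps)
    qed
    finally have "\<Delta> * ennreal (cmod (c z)) \<le> \<Delta> * (ennreal C * ?R)"
      by (simp add: ac_simps)
    then show ?thesis
      using \<Delta> by (subst (asm) ennreal_mult_le_mult_iff) auto
  qed
  then show ?thesis using C by blast
qed

text \<open>
  Every point of the disc contributes at least \<open>(1 + \<bar>R\<bar>) ^ (-4)\<close> to a bounded sum.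
\<close>
lemma finite_disc_part:
  assumes D: "decay_sum_bounded pos Y D"
  shows "finite {y\<in>Y. dist (pos y) z \<le> R}"
proof (rule ccontr)
  assume inf: "infinite {y\<in>Y. dist (pos y) z \<le> R}"
  define a where "a = 1 / (1 + \<bar>R\<bar>) ^ 4"
  have a: "0 < a" by (simp add: a_def add_pos_nonneg)
  obtain N :: nat where N: "D / a < real N" using reals_Archimedean2 by blast
  obtain F where F: "finite F" "F \<subseteq> {y\<in>Y. dist (pos y) z \<le> R}" "card F = N"
    using infinite_arbitrarily_large[OF inf] by blast
  have "real N * a = (\<Sum>y\<in>F. a)" using F by simp
  also have "\<dots> \<le> (\<Sum>y\<in>F. decay 4 (pos y) z)"
    unfolding decay_def a_def using F(2)
    by (intro sum_mono frac_le power_mono zero_less_power) (auto intro: add_pos_nonneg)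
  also have "\<dots> \<le> D"
    using F by (intro decay_sum_boundedD(2)[OF D]) auto
  finally show False using N a by (simp add: divide_less_eq)
qed

text \<open>
  The pointwise bound extends to bounded sequences by truncating \<open>c\<close> to discs around \<open>z\<close>. The part
  outside the disc of radius \<open>k\<close> affects \<open>T c\<close> at \<open>x\<close> noticeably only if \<open>x\<close> is far from \<open>z\<close>, where the factor
  \<open>decay 2 (pos x) z\<close> is small: the triangle inequality turns one order of decay in \<open>dist x y\<close> and one in
  \<open>dist x z\<close> into a factor \<open>1 / (1 + k)\<close>.
\<close>
lemma pointwise_bound_bounded:
  fixes T :: "'x \<Rightarrow> complex \<Rightarrow> complex"
  assumes Y: "decay_sum_bounded (\<lambda>y. y) Y D"
    and T: "\<And>n. \<exists>K\<ge>0. \<forall>x\<in>X. \<forall>y\<in>Y. cmod (T x y) \<le> K * decay n (pos x) y"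
    and C: "\<And>c z. c \<in> finitely_supported Y \<Longrightarrow> z \<in> Y \<Longrightarrow>
      ennreal (cmod (c z)) \<le> ennreal C * (SUP x\<in>X. ennreal (decay 2 (pos x) z) * ennreal (cmod (mat_apply Y T c x)))"
      "0 < C"
    and c: "\<And>y. y \<in> Y \<Longrightarrow> cmod (c y) \<le> A" and z: "z \<in> Y"
  shows "ennreal (cmod (c z)) \<le> ennreal C * (SUP x\<in>X. ennreal (decay 2 (pos x) z) * ennreal (cmod (mat_apply Y T c x)))"
proof -
  let ?R = "\<lambda>c. SUP x\<in>X. ennreal (decay 2 (pos x) z) * ennreal (cmod (mat_apply Y T c x))"
  obtain K where K: "0 \<le> K" "\<And>x y. x \<in> X \<Longrightarrow> y \<in> Y \<Longrightarrow> cmod (T x y) \<le> K * decay 5 (pos x) y"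
    using T by metis
  have A: "0 \<le> A" using c[OF z] norm_ge_zero order_trans by blast
  have D0: "0 < D" by (rule decay_sum_boundedD(1)[OF Y])
  define b where "b = D * (K * A)"
  have b: "0 \<le> b" using A D0 K by (simp add: b_def)
  have trunc: "ennreal (cmod (c z)) \<le> ennreal C * (?R c + ennreal (b / (1 + real k)))" for k :: nat
  proof -
    define ck where "ck y = (if dist y z \<le> real k then c y else 0)" for y
    have "ck \<in> finitely_supported Y"
      unfolding finitely_supported_def mem_Collect_eq
      by (rule finite_subset[OF _ finite_disc_part[OF Y, of z "real k"]]) (auto simp: ck_def)
    then have "ennreal (cmod (c z)) \<le> ennreal C * ?R ck"
      using C(1)[of ck z] z by (simp add: ck_def)
    also have "?R ck \<le> ?R c + ennreal (b / (1 + real k))"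
    proof (rule SUP_least)
      fix x assume x: "x \<in> X"
      let ?u = "pos x"
      have row: "cmod (T x y * a) \<le> decay 4 y ?u * (K * A)" if "y \<in> Y" "cmod a \<le> A" for y a
      proof -
        have "cmod (T x y * a) \<le> (K * decay 5 ?u y) * A"
          unfolding norm_mult using K x that A by (intro mult_mono) auto
        also have "\<dots> \<le> (K * decay 4 ?u y) * A"
          using K A by (intro mult_right_mono mult_left_mono decay_antimono) auto
        finally show ?thesis by (simp add: decay_commute[of 4 ?u] ac_simps)
      qed
      have s1: "(\<lambda>y. T x y * c y) summable_on Y"
        by (rule decay_row_sum(1)[OF Y, where u = ?u and H = "K * A"]) (use row c K A in auto)
      have far: "cmod (T x y * (ck y - c y)) \<le> decay 4 y ?u * (K * A / (1 + real k) / decay 1 ?u z)"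
        if y: "y \<in> Y" for y
      proof (cases "dist y z \<le> real k")
        case True
        then show ?thesis using K A by (simp add: ck_def)
      next
        case False
        have "decay 1 ?u z * decay 1 ?u y \<le> decay 1 z y"
          using decay_triangle[of 1 z ?u y] by (simp add: decay_commute)
        also have "\<dots> \<le> 1 / (1 + real k)"
          using False by (simp add: decay_def dist_commute frac_le)
        finally have d1: "decay 1 ?u y \<le> 1 / (1 + real k) / decay 1 ?u z"
          using decay_pos[of 1 ?u z] by (simp add: le_divide_eq ac_simps)
        have "cmod (T x y * (ck y - c y)) \<le> (K * (decay 4 ?u y * decay 1 ?u y)) * A"
          unfolding norm_mult using K(2)[OF x y] c[OF y] False A K(1)
          by (intro mult_mono) (auto simp: ck_def simp flip: decay_add)
        also have "\<dots> \<le> (K * (decay 4 ?u y * (1 / (1 + real k) / decay 1 ?u z))) * A"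
          using K(1) A d1 by (intro mult_right_mono mult_left_mono) auto
        finally show ?thesis by (simp add: decay_commute[of 4 ?u] ac_simps)
      qed
      have s2: "(\<lambda>y. T x y * (ck y - c y)) summable_on Y"
        by (rule decay_row_sum(1)[OF Y _ far]) (use K A in auto)
      have "mat_apply Y T ck x = (\<Sum>\<^sub>\<infinity>y\<in>Y. T x y * c y + T x y * (ck y - c y))"
        unfolding mat_apply_def by (rule infsum_cong) (simp add: algebra_simps)
      also have "\<dots> = mat_apply Y T c x + (\<Sum>\<^sub>\<infinity>y\<in>Y. T x y * (ck y - c y))"
        unfolding mat_apply_def by (rule infsum_add[OF s1 s2])
      finally have "cmod (mat_apply Y T ck x) \<le> cmod (mat_apply Y T c x) + D * (K * A / (1 + real k) / decay 1 ?u z)"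
        using norm_triangle_ineq[of "mat_apply Y T c x" "\<Sum>\<^sub>\<infinity>y\<in>Y. T x y * (ck y - c y)"]
          decay_row_sum(2)[OF Y _ far] K A by fastforce
      then have "decay 2 ?u z * cmod (mat_apply Y T ck x)
          \<le> decay 2 ?u z * (cmod (mat_apply Y T c x) + D * (K * A / (1 + real k) / decay 1 ?u z))"
        by (rule mult_left_mono) simp
      also have "\<dots> = decay 2 ?u z * cmod (mat_apply Y T c x) + decay 1 ?u z * (b / (1 + real k))"
      proof -
        have "d * d * (D * (t / d)) = d * (D * t)" if "0 < d" for d t :: real
          using that by simp
        moreover have "decay 2 ?u z = decay 1 ?u z * decay 1 ?u z"
          using decay_add[of 1 1 ?u z] by (simp only: one_add_one)
        ultimately have "decay 2 ?u z * (D * (K * A / (1 + real k) / decay 1 ?u z)) = decay 1 ?u z * (D * (K * A / (1 + real k)))"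
          by (simp only: decay_pos)
        then show ?thesis by (simp only: b_def distrib_left times_divide_eq_right)
      qed
      also have "\<dots> \<le> decay 2 ?u z * cmod (mat_apply Y T c x) + 1 * (b / (1 + real k))"
        using b by (intro add_left_mono mult_right_mono decay_le_1) auto
      finally have "ennreal (decay 2 ?u z * cmod (mat_apply Y T ck x))
          \<le> ennreal (decay 2 ?u z * cmod (mat_apply Y T c x) + b / (1 + real k))"
        by (intro ennreal_leI) simp
      also have "\<dots> = ennreal (decay 2 ?u z) * ennreal (cmod (mat_apply Y T c x)) + ennreal (b / (1 + real k))"
        using b by (simp add: ennreal_mult)
      also have "\<dots> \<le> ?R c + ennreal (b / (1 + real k))"
        using x by (intro add_right_mono SUP_upper) auto
      finally show "ennreal (decay 2 ?u z) * ennreal (cmod (mat_apply Y T ck x)) \<le> ?R c + ennreal (b / (1 + real k))"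
        by (simp add: ennreal_mult)
    qed
    finally show ?thesis by (simp add: mult_left_mono)
  qed
  show ?thesis
  proof (cases "?R c = top")
    case True
    show ?thesis unfolding True using C(2) by (simp add: ennreal_mult_top)
  next
    case False
    then obtain r where r: "?R c = ennreal r" "0 \<le> r" by (cases "?R c") auto
    have "cmod (c z) \<le> C * (r + b * inverse (real (Suc k)))" for k
    proof -
      have "ennreal (cmod (c z)) \<le> ennreal (C * (r + b * inverse (real (Suc k))))"
        using trunc[of k] r b C(2) by (simp add: ennreal_mult inverse_eq_divide add.commute flip: ennreal_plus)
      then show ?thesis using r b C(2) by (subst (asm) ennreal_le_iff) auto
    qed
    moreover have "(\<lambda>k. C * (r + b * inverse (real (Suc k)))) \<longlonglongrightarrow> C * (r + b * 0)"
      by (intro tendsto_intros LIMSEQ_inverse_real_of_nat)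
    ultimately have "cmod (c z) \<le> C * r"
      using LIMSEQ_le_const by fastforce
    then show ?thesis using r C(2) by (simp add: ennreal_leI flip: ennreal_mult)
  qed
qed

section \<open>Stability in \<open>\<ell>\<^sup>2\<close>\<close>

lemma le_lp_norm:
  assumes "0 < p" "i \<in> S"
  shows "f i \<le> lp_norm p S f"
proof -
  have "f i = lp_norm p S (\<lambda>j. if j = i then f i else 0)"
    using assms by (subst lp_norm_single[of p i]) auto
  also have "\<dots> \<le> lp_norm p S f"
    using assms by (intro lp_norm_mono) auto
  finally show ?thesis .
qed

lemma l2_space_bounded:
  assumes "c \<in> l2_space S"
  obtains A where "\<And>i. i \<in> S \<Longrightarrow> cmod (c i) \<le> A"
proof -
  have fin: "seq_norm 2 S c < top" using assms by (simp add: l2_space_def)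
  have "cmod (c i) \<le> enn2real (seq_norm 2 S c)" if "i \<in> S" for i
  proof -
    have "ennreal (cmod (c i)) \<le> seq_norm 2 S c"
      unfolding seq_norm_def using that by (intro le_lp_norm) auto
    then show ?thesis using fin by (cases "seq_norm 2 S c") (auto simp: ennreal_le_iff)
  qed
  then show ?thesis by (rule that)
qed

lemma rapidly_localized_decay:
  assumes "rapidly_localized X Y T"
  shows "\<exists>K\<ge>0. \<forall>x\<in>X. \<forall>y\<in>Y. cmod (T x y) \<le> K * decay n (snd x) y"
proof -
  obtain K where K: "0 < K" "\<And>x y. x \<in> X \<Longrightarrow> y \<in> Y \<Longrightarrow> cmod (T x y) \<le> K * (1 + cmod (snd x - y)) powr (- real (Suc n))"
    using assms unfolding rapidly_localized_def by (metis of_nat_0_less_iff zero_less_Suc)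
  have "cmod (T x y) \<le> K * decay n (snd x) y" if xy: "x \<in> X" "y \<in> Y" for x y
  proof -
    have "(1 + cmod (snd x - y)) powr (- real (Suc n)) = decay (Suc n) (snd x) y"
      by (simp add: decay_def dist_norm powr_minus_divide add_pos_nonneg powr_realpow del: of_nat_Suc power_Suc)
    also have "\<dots> \<le> decay n (snd x) y" by (rule decay_antimono) simp
    finally have "K * (1 + cmod (snd x - y)) powr (- real (Suc n)) \<le> K * decay n (snd x) y"
      using K(1) by simp
    then show ?thesis using K(2)[OF xy] by simp
  qed
  then show ?thesis using K(1) by (intro exI[of _ K]) auto
qed

text \<open>
  The pointwise bound says that \<open>\<bar>c\<bar>\<close> is dominated by a maximal function of \<open>\<bar>T c\<bar>\<close> of decay order two,
  which the Schur test bounds in \<open>\<ell>\<^sup>2\<close> since \<open>2 * 2 \<ge> 4\<close>.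
\<close>
theorem theorem5p7:
  fixes Y :: "complex set" and J :: nat and Xs :: "nat \<Rightarrow> complex set"
    and X :: "(nat \<times> complex) set"
    and T :: "nat \<times> complex \<Rightarrow> complex \<Rightarrow> complex"
    and p q :: ennreal and \<nu> C0 :: real
  assumes "relatively_separated Y"
    and "J \<ge> 1"
    and "\<And>j. j \<in> {1..J} \<Longrightarrow> relatively_separated (Xs j)"
    and "X = labeled_union J Xs"
    and "rapidly_localized X Y T"
    and "0 < p" and "0 < q"
    and "C0 > 0"
    and "\<And>c. c \<in> finitely_supported Y \<Longrightarrow>
           mixed_norm (\<lambda>z. z) p q \<nu> Y c \<le> ennreal C0 * mixed_norm snd p q \<nu> X (mat_apply Y T c)"
  shows "\<exists>C>0. \<forall>c\<in>l2_space Y.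
           seq_norm 2 Y c \<le> ennreal C * seq_norm 2 X (mat_apply Y T c)"
proof -
  obtain DX where DX: "decay_sum_bounded snd X DX"
    using labeled_union_ulf[of J Xs] assms(3,4) ulf_imp_decay_sum_bounded by blast
  obtain DY where DY: "decay_sum_bounded (\<lambda>y. y) Y DY"
    using relatively_separated_imp_ulf[OF assms(1)] ulf_imp_decay_sum_bounded by blast
  note T = rapidly_localized_decay[OF assms(5)]
  obtain C where C: "0 < C" and fin: "\<And>c z. c \<in> finitely_supported Y \<Longrightarrow> z \<in> Y \<Longrightarrow>
      ennreal (cmod (c z)) \<le> ennreal C * (SUP x\<in>X. ennreal (decay 2 (snd x) z) * ennreal (cmod (mat_apply Y T c x)))"
    using pointwise_bound_finite_support[OF DX DY T assms(6-9)] by blast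
  have "seq_norm 2 Y c \<le> ennreal (schur_bound 2 DY * C) * seq_norm 2 X (mat_apply Y T c)" if c: "c \<in> l2_space Y" for c
  proof -
    obtain A where A: "\<And>y. y \<in> Y \<Longrightarrow> cmod (c y) \<le> A" using l2_space_bounded[OF c] by blast
    have "lp_norm 2 Y (\<lambda>z. ennreal (cmod (c z)))
        \<le> ennreal (schur_bound 2 DY) * lp_norm 2 X (\<lambda>x. ennreal C * ennreal (cmod (mat_apply Y T c x)))"
    proof (rule lp_norm_decay_bound[OF DY, where N = 2 and pos' = snd])
      fix z assume "z \<in> Y"
      then have "ennreal (cmod (c z)) \<le> ennreal C * (SUP x\<in>X. ennreal (decay 2 (snd x) z) * ennreal (cmod (mat_apply Y T c x)))"
        by (intro pointwise_bound_bounded[OF DY T fin C A])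
      then show "ennreal (cmod (c z)) \<le> (SUP x\<in>X. ennreal (decay 2 z (snd x)) * (ennreal C * ennreal (cmod (mat_apply Y T c x))))"
        by (simp add: SUP_mult_left_ennreal decay_commute mult.left_commute)
    qed auto
    then show ?thesis
      using C schur_bound_pos[OF DY, of 2] by (simp add: seq_norm_def lp_norm_cmult ennreal_mult mult.assoc)
  qed
  then show ?thesis
    using C schur_bound_pos[OF DY, of 2] by (intro exI[of _ "schur_bound 2 DY * C"]) auto
qed

end
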